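(* Let $d, r \in \mathbb{N}$. (1) The linear functional $\mu^{(\infty,d)} : \mathbb{C}\langle \{X_p \mid p \in \mathbb{N}\}\rangle \to \mathbb{C}$ is positive, that is, $\mu^{(\infty,d)}(P^*P) \ge 0$ for all $P \in \mathbb{C}\langle \{X_p \mid p\in\mathbb{N}\}\rangle$. Consequently, the restriction $$\mu^{(r,d)} := \mu^{(\infty,d)} \mid \mathbb{C}\langle X_1,\ldots,X_r\rangle$$ belongs to the space of distributions $\mathcal{D}_r$. (2) Let $\underline{\gamma} : \{1,\ldots,r\}\times\mathbb{N} \to \{\gamma_n \mid n\in\mathbb{N}\}$ be an injective function, let $$s_{p,n} := \frac{1}{\sqrt{n}} \Bigl( \underline{\gamma}(p,1)+\cdots+\underline{\gamma}(p,n) - \frac{n}{d}\Bigr) \in \mathbb{C}[S_\infty], \quad 1\le p\le r,\ n \in \mathbb{N},$$ and let $\mu_n \in \mathcal{D}_r$ be the joint distribution of the $r$-tuple $s_{1,n},\ldots,s_{r,n}$ in $(\mathbb{C}[S_\infty],\varphi_d)$. Then the sequence $(\mu_n)_{n=1}^\infty$ converges in moments to the distribution $\mu^{(r,d)}$.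
   Context: $\mathbb{N} = \{1,2,\ldots\}$. $S_\infty$ is the group of bijections $\tau : \mathbb{N}\to\mathbb{N}$ for which there is $k_o$ with $\tau(k)=k$ for all $k>k_o$; $\|\tau\|$ is the minimal number of transpositions in a factorization of $\tau$ into transpositions ($0$ for the identity); $\varphi_d : \mathbb{C}[S_\infty]\to\mathbb{C}$ is the linear functional with $\varphi_d(\tau) = (1/d)^{\|\tau\|}$ for $\tau\in S_\infty$; the $*$-operation on $\mathbb{C}[S_\infty]$ is determined by $\tau^*=\tau^{-1}$; $\varphi_d$ is positive, so $(\mathbb{C}[S_\infty],\varphi_d)$ is a $*$-probability space (unital $*$-algebra over $\mathbb{C}$ with a positive linear functional taking $1$ to $1$). The star-generators are $\gamma_n=(1,n+1)$, $n\in\mathbb{N}$; scalars in $\mathbb{C}[S_\infty]$ mean multiples of the unit. $\mathcal{P}(k)$ is the set of partitions of $\{1,\ldots,k\}$ ordered by reverse refinement ($\pi\le\rho$ iff every block of $\pi$ is contained in a block of $\rho$); $\mathcal{P}_2(k)$ is the set of those with all blocks of cardinality $2$ (empty for $k$ odd). For $\underline{i}=(\underline{i}(1),\ldots,\underline{i}(k))\in\mathbb{N}^k$, $\mathrm{Ker}(\underline{i})\in\mathcal{P}(k)$ is the partition of $\{1,\ldots,k\}$ into level sets of $\underline{i}$. A sequence $(a_n)$ of selfadjoint elements in a $*$-probability space $(\mathcal{A},\varphi)$ is exchangeable if $\varphi(a_{\underline{i}(1)}\cdots a_{\underline{i}(k)}) = \varphi(a_{\underline{j}(1)}\cdots a_{\underline{j}(k)})$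 whenever $\mathrm{Ker}(\underline{i})=\mathrm{Ker}(\underline{j})$; its function on partitions $\mathbf{t} : \sqcup_{k=1}^\infty\mathcal{P}(k)\to\mathbb{C}$ is then $\mathbf{t}(\pi) := \varphi(a_{\underline{i}(1)}\cdots a_{\underline{i}(k)})$ for any $\underline{i}\in\mathbb{N}^k$ with $\mathrm{Ker}(\underline{i})=\pi$. $\mathbb{C}\langle\{X_p\mid p\in\mathbb{N}\}\rangle$ is the algebra of polynomials in countably many non-commuting indeterminates, with the $*$-operation determined by $X_p^*=X_p$. The sequence $(\gamma_n-\frac1d)_{n=1}^\infty$ is exchangeable in $(\mathbb{C}[S_\infty],\varphi_d)$; let $\mathbf{t}_d$ be its function on partitions. The functional $\mu^{(\infty,d)}$ is the linear functional with $\mu^{(\infty,d)}(1)=1$ and, for all $k\in\mathbb{N}$ and $\underline{i}\in\mathbb{N}^k$, $$\mu^{(\infty,d)}(X_{\underline{i}(1)}\cdots X_{\underline{i}(k)}) = \sum_{\pi\in\mathcal{P}_2(k),\ \pi\le\mathrm{Ker}(\underline{i})}\mathbf{t}_d(\pi)$$ (an empty sum being $0$). $\mathcal{D}_r$ is the set of positive linear functionals $\mu$ on $\mathbb{C}\langle X_1,\ldots,X_r\rangle$ with $\mu(1)=1$, where positive means $\mu(P^*P)\ge0$ for all $P$. The joint distribution of selfadjoint $a_1,\ldots,a_r$ in $(\mathcal{A},\varphi)$ is the functional $\mu \in \mathcal{D}_r$ with $\mu(X_{i(1)}\cdots X_{i(k)})=\varphi(a_{i(1)}\cdots a_{i(k)})$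 for all $k$ and all $(i(1),\ldots,i(k)) \in \{1,\ldots,r\}^k$. Convergence in moments means pointwise convergence on $\mathbb{C}\langle X_1,\ldots,X_r\rangle$. *)

theory Defs
  imports
    Complex_Main
    "HOL-Library.Poly_Mapping"
    "HOL-Library.FuncSet"
    "HOL-Library.Disjoint_Sets"
    "HOL-Library.Nonpos_Ints"
    "HOL-Combinatorics.Permutations"
begin

text \<open>
  The natural numbers of the source start at 1, so index sets are subsets of \<open>{1..} :: nat set\<close>.

  Both algebras that occur are monoid algebras over the complex numbers: finitely supported
  functions on a monoid with the convolution product of \<^theory>\<open>HOL-Library.Poly_Mapping\<close>.
  That theory takes the underlying monoid additively written (without assuming commutativity),
  so composition of permutations and concatenation of words are both written \<open>+\<close>, with
  neutral element \<open>0\<close>. The basis element of a monoid element \<open>m\<close> is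
  \<open>Poly_Mapping.single m 1\<close>.
\<close>

definition scalar :: "complex \<Rightarrow> ('m::monoid_add \<Rightarrow>\<^sub>0 complex)" where
  "scalar c = Poly_Mapping.single 0 c"

definition lin_ext :: "('m \<Rightarrow> complex) \<Rightarrow> ('m \<Rightarrow>\<^sub>0 complex) \<Rightarrow> complex" where
  "lin_ext f P = (\<Sum>m\<in>Poly_Mapping.keys P. Poly_Mapping.lookup P m * f m)"


section \<open>The infinite symmetric group and its group algebra\<close>

typedef S_inf = "{f :: nat \<Rightarrow> nat. f permutes {1..} \<and> (\<exists>k0. \<forall>k>k0. f k = k)}"
  by (rule exI[of _ id]) (auto simp: permutes_id)

setup_lifting type_definition_S_inf

instantiation S_inf :: group_add
begin

lift_definition zero_S_inf :: S_inf is id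
  by (simp add: permutes_id)

lift_definition plus_S_inf :: "S_inf \<Rightarrow> S_inf \<Rightarrow> S_inf" is "\<lambda>f g. f \<circ> g"
proof (rule conjI)
  fix f g :: "nat \<Rightarrow> nat"
  assume f: "f permutes {1..} \<and> (\<exists>k0. \<forall>k>k0. f k = k)"
    and g: "g permutes {1..} \<and> (\<exists>k0. \<forall>k>k0. g k = k)"
  show "f \<circ> g permutes {1..}"
    using f g permutes_compose by blast
  from f g obtain k1 k2 where "\<forall>k>k1. f k = k" "\<forall>k>k2. g k = k"
    by blast
  then have "\<forall>k>max k1 k2. (f \<circ> g) k = k"
    by simp
  then show "\<exists>k0. \<forall>k>k0. (f \<circ> g) k = k" ..
qed

lift_definition uminus_S_inf :: "S_inf \<Rightarrow> S_inf" is inv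
proof (rule conjI)
  fix f :: "nat \<Rightarrow> nat"
  assume f: "f permutes {1..} \<and> (\<exists>k0. \<forall>k>k0. f k = k)"
  then show "inv f permutes {1..}"
    using permutes_inv by blast
  from f show "\<exists>k0. \<forall>k>k0. inv f k = k"
    by (metis permutes_inv_eq)
qed

definition minus_S_inf :: "S_inf \<Rightarrow> S_inf \<Rightarrow> S_inf" where
  "minus_S_inf f g = f + (- g)"

instance
proof
  fix a b c :: S_inf
  show "a + b + c = a + (b + c)"
    by transfer (simp add: comp_assoc)
  show "0 + a = a"
    by transfer simp
  show "a + 0 = a"
    by transfer simp
  show "- a + a = 0"
    by transfer (use permutes_inv_o(2) in blast)
  show "a + - b = a - b"
    by (simp add: minus_S_inf_def)
qed

end

definition is_transposition :: "S_inf \<Rightarrow> bool" where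
  "is_transposition \<tau> \<longleftrightarrow>
     (\<exists>i j. 1 \<le> i \<and> 1 \<le> j \<and> i \<noteq> j \<and> Rep_S_inf \<tau> = Transposition.transpose i j)"

definition transp_length :: "S_inf \<Rightarrow> nat" where
  "transp_length \<tau> =
     (LEAST n. \<exists>ts. length ts = n \<and> (\<forall>t\<in>set ts. is_transposition t) \<and> sum_list ts = \<tau>)"

type_synonym group_algebra = "S_inf \<Rightarrow>\<^sub>0 complex"

definition phi :: "nat \<Rightarrow> group_algebra \<Rightarrow> complex" where
  "phi d = lin_ext (\<lambda>\<tau>. (1 / of_nat d) ^ transp_length \<tau>)"

definition star_gen :: "nat \<Rightarrow> group_algebra" where
  "star_gen n = Poly_Mapping.single (Abs_S_inf (Transposition.transpose 1 (n + 1))) 1"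


section \<open>Partitions\<close>

definition pair_partitions :: "nat \<Rightarrow> nat set set set" where
  "pair_partitions k = {\<pi>. partition_on {1..k} \<pi> \<and> (\<forall>B\<in>\<pi>. card B = 2)}"

text \<open>A tuple \<open>(i(1), \<dots>, i(k))\<close> is a list of length \<open>k\<close>; its \<open>m\<close>-th entry is \<open>i ! (m - 1)\<close>.\<close>

definition Ker :: "nat list \<Rightarrow> nat set set" where
  "Ker i = (\<lambda>m. {m' \<in> {1..length i}. i ! (m' - 1) = i ! (m - 1)}) ` {1..length i}"

text \<open>
  The function on partitions of an exchangeable sequence: the value at a partition \<open>\<pi>\<close> of
  \<open>{1..k}\<close> is the common value of the moments indexed by all tuples with kernel \<open>\<pi>\<close>.
\<close>

definition partition_fun ::
    "('a::monoid_mult \<Rightarrow> complex) \<Rightarrow> (nat \<Rightarrow> 'a) \<Rightarrow> nat \<Rightarrow> nat set set \<Rightarrow> complex" where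
  "partition_fun \<phi> a k \<pi> =
     (THE z. \<forall>i. length i = k \<and> set i \<subseteq> {1..} \<and> Ker i = \<pi> \<longrightarrow> z = \<phi> (prod_list (map a i)))"

definition t_fun :: "nat \<Rightarrow> nat \<Rightarrow> nat set set \<Rightarrow> complex" where
  "t_fun d = partition_fun (phi d) (\<lambda>n. star_gen n - scalar (1 / of_nat d))"


section \<open>Non-commutative polynomials and distributions\<close>

datatype nc_word = Word (letters: "nat list")

instantiation nc_word :: monoid_add
begin

definition zero_nc_word :: nc_word where
  "0 = Word []"

definition plus_nc_word :: "nc_word \<Rightarrow> nc_word \<Rightarrow> nc_word" where
  "u + v = Word (letters u @ letters v)"

instance
  by standard (simp_all add: zero_nc_word_def plus_nc_word_def)

end

text \<open>
  The word with letters \<open>i(1), \<dots>, i(k)\<close> stands for the monomial \<open>X_{i(1)} \<cdots> X_{i(k)}\<close>.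
\<close>

type_synonym ncpoly = "nc_word \<Rightarrow>\<^sub>0 complex"

definition ncpolys :: "nat set \<Rightarrow> ncpoly set" where
  "ncpolys I = {P. \<forall>w\<in>Poly_Mapping.keys P. set (letters w) \<subseteq> I}"

definition ncpoly_star :: "ncpoly \<Rightarrow> ncpoly" where
  "ncpoly_star P =
     (\<Sum>w\<in>Poly_Mapping.keys P.
        Poly_Mapping.single (Word (rev (letters w))) (cnj (Poly_Mapping.lookup P w)))"

text \<open>
  A functional on \<open>ncpolys I\<close> is a function that is \<open>undefined\<close> off \<open>ncpolys I\<close>, so that
  equality of functionals means agreement on \<open>ncpolys I\<close>.
\<close>

definition linear_functionals :: "nat set \<Rightarrow> (ncpoly \<Rightarrow> complex) set" where
  "linear_functionals I = {\<mu> \<in> extensional (ncpolys I).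
     (\<forall>P\<in>ncpolys I. \<forall>Q\<in>ncpolys I. \<mu> (P + Q) = \<mu> P + \<mu> Q) \<and>
     (\<forall>c. \<forall>P\<in>ncpolys I. \<mu> (scalar c * P) = c * \<mu> P)}"

definition positive_functional :: "nat set \<Rightarrow> (ncpoly \<Rightarrow> complex) \<Rightarrow> bool" where
  "positive_functional I \<mu> \<longleftrightarrow> (\<forall>P\<in>ncpolys I. \<mu> (ncpoly_star P * P) \<in> \<real>\<^sub>\<ge>\<^sub>0)"

definition distributions :: "nat \<Rightarrow> (ncpoly \<Rightarrow> complex) set" where
  "distributions r =
     {\<mu> \<in> linear_functionals {1..r}. positive_functional {1..r} \<mu> \<and> \<mu> 1 = 1}"

definition joint_distribution ::
    "('a::monoid_mult \<Rightarrow> complex) \<Rightarrow> nat \<Rightarrow> (nat \<Rightarrow> 'a) \<Rightarrow> ncpoly \<Rightarrow> complex" where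
  "joint_distribution \<phi> r a =
     restrict (lin_ext (\<lambda>w. \<phi> (prod_list (map a (letters w))))) (ncpolys {1..r})"

definition converges_in_moments ::
    "nat \<Rightarrow> (nat \<Rightarrow> ncpoly \<Rightarrow> complex) \<Rightarrow> (ncpoly \<Rightarrow> complex) \<Rightarrow> bool" where
  "converges_in_moments r \<mu>s \<mu> \<longleftrightarrow> (\<forall>P\<in>ncpolys {1..r}. (\<lambda>n. \<mu>s n P) \<longlonglongrightarrow> \<mu> P)"


section \<open>The limit functional and the normalized sums\<close>

definition limit_moment :: "nat \<Rightarrow> nat list \<Rightarrow> complex" where
  "limit_moment d i =
     (if i = [] then 1
      else \<Sum>\<pi> | \<pi> \<in> pair_partitions (length i) \<and> refines {1..length i} \<pi> (Ker i).
             t_fun d (length i) \<pi>)"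

definition mu_inf :: "nat \<Rightarrow> ncpoly \<Rightarrow> complex" where
  "mu_inf d = restrict (lin_ext (\<lambda>w. limit_moment d (letters w))) (ncpolys {1..})"

definition mu_r :: "nat \<Rightarrow> nat \<Rightarrow> ncpoly \<Rightarrow> complex" where
  "mu_r r d = restrict (mu_inf d) (ncpolys {1..r})"

definition normalized_sum ::
    "nat \<Rightarrow> (nat \<times> nat \<Rightarrow> group_algebra) \<Rightarrow> nat \<Rightarrow> nat \<Rightarrow> group_algebra" where
  "normalized_sum d g n p =
     scalar (1 / of_real (sqrt (real n))) *
       ((\<Sum>m=1..n. g (p, m)) - scalar (of_nat n / of_nat d))"

end

theory Submission
  imports Defs "HOL-Library.Nat_Bijection"
begin

text \<open>
  Colourings \<open>f : {1, \<dots>, N} \<rightarrow> {1, \<dots>, d}\<close> carry the permutation action of \<open>S\<^sub>N\<close>. Composing a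
  permutation with a transposition changes its number of cycles by one, so a permutation \<open>\<tau>\<close>
  has exactly \<open>d ^ (N - \<parallel>\<tau>\<parallel>)\<close> invariant colourings, and \<open>\<phi>(\<tau>)\<close> is the proportion of
  invariant colourings. This makes \<open>\<phi>\<close> a positive trace.

  Conjugation by permutations fixing \<open>1\<close> permutes the star-generators, which gives exchangeability
  of the centred generators \<open>\<gamma>\<^sub>n - 1/d\<close>. A factor \<open>\<gamma>\<^sub>n - 1/d\<close> whose index occurs only once makes
  the moment vanish, because multiplying a permutation that fixes \<open>n + 1\<close> by \<open>(1, n + 1)\<close> raises
  the length by exactly one.

  In the expansion of a moment of the normalized sums of order \<open>k\<close>, grouped by the kernel \<open>\<pi>\<close>
  of the index tuple, a partition \<open>\<pi>\<close> occurs \<open>O(n ^ |\<pi>|)\<close> times against the factor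
  \<open>n ^ (-k/2)\<close>. Partitions with a singleton do not contribute, all others except the pairings
  have \<open>|\<pi>| < k/2\<close>, and a pairing below the kernel of the word occurs asymptotically
  \<open>n ^ (k/2)\<close> times. The limit functional is positive as a limit of joint distributions.
\<close>

section \<open>Linear functionals and involutions on monoid algebras\<close>

lemma poly_mapping_sum_single:
  "(\<Sum>m\<in>Poly_Mapping.keys P. Poly_Mapping.single m (Poly_Mapping.lookup P m)) = P"
proof (rule poly_mapping_eqI)
  fix k
  show "Poly_Mapping.lookup
      (\<Sum>m\<in>Poly_Mapping.keys P. Poly_Mapping.single m (Poly_Mapping.lookup P m)) k =
      Poly_Mapping.lookup P k"
    by (cases "k \<in> Poly_Mapping.keys P")
      (auto simp: lookup_sum lookup_single when_def in_keys_iff)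
qed

lemma lin_ext_superset:
  assumes "finite K" and "Poly_Mapping.keys P \<subseteq> K"
  shows "lin_ext f P = (\<Sum>m\<in>K. Poly_Mapping.lookup P m * f m)"
  unfolding lin_ext_def
  by (rule sum.mono_neutral_left) (use assms in \<open>auto simp: in_keys_iff\<close>)

lemma lin_ext_add: "lin_ext f (P + Q) = lin_ext f P + lin_ext f Q"
proof -
  let ?K = "Poly_Mapping.keys P \<union> Poly_Mapping.keys Q"
  have "Poly_Mapping.keys (P + Q) \<subseteq> ?K"
    by (rule keys_add)
  then show ?thesis
    by (simp add: lin_ext_superset[of ?K] lookup_add distrib_right sum.distrib)
qed

lemma lin_ext_zero [simp]: "lin_ext f 0 = 0"
  by (simp add: lin_ext_def)

lemma lin_ext_single [simp]: "lin_ext f (Poly_Mapping.single m c) = c * f m"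
  by (simp add: lin_ext_def)

lemma lin_ext_sum: "lin_ext f (\<Sum>x\<in>A. P x) = (\<Sum>x\<in>A. lin_ext f (P x))"
  by (induction A rule: infinite_finite_induct) (simp_all add: lin_ext_add)

lemma lin_ext_diff: "lin_ext f (P - Q) = lin_ext f P - lin_ext f Q"
  using lin_ext_add[of f "P - Q" Q] by simp

lemma mult_expand:
  fixes P Q :: "'m::monoid_add \<Rightarrow>\<^sub>0 complex"
  shows "P * Q = (\<Sum>u\<in>Poly_Mapping.keys P. \<Sum>v\<in>Poly_Mapping.keys Q.
    Poly_Mapping.single (u + v) (Poly_Mapping.lookup P u * Poly_Mapping.lookup Q v))"
proof -
  have "P * Q = (\<Sum>u\<in>Poly_Mapping.keys P. Poly_Mapping.single u (Poly_Mapping.lookup P u)) *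
      (\<Sum>v\<in>Poly_Mapping.keys Q. Poly_Mapping.single v (Poly_Mapping.lookup Q v))"
    by (simp add: poly_mapping_sum_single)
  then show ?thesis
    by (simp add: sum_product mult_single)
qed

lemma lin_ext_mult:
  "lin_ext f (P * Q) = (\<Sum>u\<in>Poly_Mapping.keys P. \<Sum>v\<in>Poly_Mapping.keys Q.
    Poly_Mapping.lookup P u * Poly_Mapping.lookup Q v * f (u + v))"
  by (subst mult_expand) (simp add: lin_ext_sum)

lemma mult_single_mult_expand:
  fixes P Q :: "'m::monoid_add \<Rightarrow>\<^sub>0 complex"
  shows "P * Poly_Mapping.single m 1 * Q =
    (\<Sum>u\<in>Poly_Mapping.keys P. \<Sum>v\<in>Poly_Mapping.keys Q.
      Poly_Mapping.single (u + m + v) (Poly_Mapping.lookup P u * Poly_Mapping.lookup Q v))"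
proof -
  have "P * Poly_Mapping.single m 1 * Q =
      (\<Sum>u\<in>Poly_Mapping.keys P. Poly_Mapping.single u (Poly_Mapping.lookup P u)) *
        Poly_Mapping.single m 1 *
      (\<Sum>v\<in>Poly_Mapping.keys Q. Poly_Mapping.single v (Poly_Mapping.lookup Q v))"
    by (simp add: poly_mapping_sum_single)
  then show ?thesis
    by (simp only: sum_distrib_right[of _ _ "Poly_Mapping.single m 1"] sum_product mult_single mult_1_right)
qed

lemma lin_ext_mult_single_mult:
  "lin_ext f (P * Poly_Mapping.single m 1 * Q) =
    (\<Sum>u\<in>Poly_Mapping.keys P. \<Sum>v\<in>Poly_Mapping.keys Q.
      Poly_Mapping.lookup P u * Poly_Mapping.lookup Q v * f (u + m + v))"
  by (subst mult_single_mult_expand) (simp add: lin_ext_sum)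

lemma scalar_mult_expand:
  "scalar c * P = (\<Sum>m\<in>Poly_Mapping.keys P. Poly_Mapping.single m (c * Poly_Mapping.lookup P m))"
proof -
  have "scalar c * P = scalar c *
      (\<Sum>m\<in>Poly_Mapping.keys P. Poly_Mapping.single m (Poly_Mapping.lookup P m))"
    by (simp add: poly_mapping_sum_single)
  then show ?thesis
    by (simp add: scalar_def sum_distrib_left mult_single)
qed

lemma mult_scalar_expand:
  "P * scalar c = (\<Sum>m\<in>Poly_Mapping.keys P. Poly_Mapping.single m (c * Poly_Mapping.lookup P m))"
proof -
  have "P * scalar c =
      (\<Sum>m\<in>Poly_Mapping.keys P. Poly_Mapping.single m (Poly_Mapping.lookup P m)) * scalar c"
    by (simp add: poly_mapping_sum_single)
  then show ?thesis
    by (simp add: scalar_def sum_distrib_right mult_single mult.commute)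
qed

lemma scalar_commute: "P * scalar c = scalar c * P"
  by (simp add: scalar_mult_expand mult_scalar_expand)

lemma scalar_mult: "scalar (a * b) = scalar a * scalar b"
  by (simp add: scalar_def mult_single)

lemma scalar_one [simp]: "scalar 1 = 1"
  by (simp add: scalar_def)

lemma scalar_of_nat_mult: "scalar (of_nat n * c) = (\<Sum>i=1..n. scalar c)"
  by (induction n) (simp_all add: scalar_def single_add distrib_right)

lemma lin_ext_scalar_mult: "lin_ext f (scalar c * P) = c * lin_ext f P"
  by (simp add: scalar_mult_expand lin_ext_sum)
    (simp add: lin_ext_def sum_distrib_left mult.assoc)

lemma keys_scalar_mult: "Poly_Mapping.keys (scalar c * P) \<subseteq> Poly_Mapping.keys P"
  using keys_mult[of "scalar c" P] by (auto simp: scalar_def split: if_splits)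

lemma prod_list_scalar_mult:
  "prod_list (map (\<lambda>p. scalar c * X p) w) = scalar (c ^ length w) * prod_list (map X w)"
proof (induction w)
  case (Cons p w)
  have "scalar c * X p * (scalar (c ^ length w) * prod_list (map X w)) =
      scalar c * (X p * scalar (c ^ length w)) * prod_list (map X w)"
    by (simp only: mult.assoc)
  also have "\<dots> = scalar (c ^ length (p # w)) * prod_list (map X (p # w))"
    by (simp only: scalar_commute) (simp add: scalar_mult mult.assoc)
  finally show ?case
    using Cons.IH by simp
qed simp

text \<open>Common form of both involutions: with \<open>uminus\<close> it is the star operation of
  the group algebra, with reversal of words that of the polynomials.\<close>

definition conj_ext :: "('m \<Rightarrow> 'm) \<Rightarrow> ('m \<Rightarrow>\<^sub>0 complex) \<Rightarrow> ('m \<Rightarrow>\<^sub>0 complex)" where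
  "conj_ext j P =
     (\<Sum>m\<in>Poly_Mapping.keys P. Poly_Mapping.single (j m) (cnj (Poly_Mapping.lookup P m)))"

lemma conj_ext_superset:
  assumes "finite K" and "Poly_Mapping.keys P \<subseteq> K"
  shows "conj_ext j P =
    (\<Sum>m\<in>K. Poly_Mapping.single (j m) (cnj (Poly_Mapping.lookup P m)))"
  unfolding conj_ext_def
  by (rule sum.mono_neutral_left) (use assms in \<open>auto simp: in_keys_iff\<close>)

lemma conj_ext_zero [simp]: "conj_ext j 0 = 0"
  by (simp add: conj_ext_def)

lemma conj_ext_single [simp]:
  "conj_ext j (Poly_Mapping.single m c) = Poly_Mapping.single (j m) (cnj c)"
  by (simp add: conj_ext_def)

lemma conj_ext_add: "conj_ext j (P + Q) = conj_ext j P + conj_ext j Q"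
proof -
  let ?K = "Poly_Mapping.keys P \<union> Poly_Mapping.keys Q"
  have "Poly_Mapping.keys (P + Q) \<subseteq> ?K"
    by (rule keys_add)
  then show ?thesis
    by (simp add: conj_ext_superset[of ?K] lookup_add single_add sum.distrib)
qed

lemma conj_ext_diff: "conj_ext j (P - Q) = conj_ext j P - conj_ext j Q"
  using conj_ext_add[of j "P - Q" Q] by simp

lemma conj_ext_sum: "conj_ext j (\<Sum>x\<in>A. P x) = (\<Sum>x\<in>A. conj_ext j (P x))"
  by (induction A rule: infinite_finite_induct) (simp_all add: conj_ext_add)

lemma conj_ext_mult:
  fixes P Q :: "'m::monoid_add \<Rightarrow>\<^sub>0 complex"
  assumes "\<And>a b. j (a + b) = j b + j a"
  shows "conj_ext j (P * Q) = conj_ext j Q * conj_ext j P"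
proof -
  have "conj_ext j (P * Q) = (\<Sum>u\<in>Poly_Mapping.keys P. \<Sum>v\<in>Poly_Mapping.keys Q.
      Poly_Mapping.single (j v + j u)
        (cnj (Poly_Mapping.lookup Q v) * cnj (Poly_Mapping.lookup P u)))"
    by (subst mult_expand) (simp add: conj_ext_sum assms mult.commute)
  also have "\<dots> = conj_ext j Q * conj_ext j P"
    unfolding conj_ext_def by (subst sum.swap) (simp add: sum_product mult_single)
  finally show ?thesis .
qed

lemma ncpoly_star_conv_conj_ext: "ncpoly_star = conj_ext (\<lambda>w. Word (rev (letters w)))"
  by (rule ext) (simp add: ncpoly_star_def conj_ext_def)

text \<open>Expanding \<open>conj_ext\<close> by its definition keeps the summation over the keys of
  \<open>P\<close> itself. With \<open>P = Q\<close> this is the sesquilinear form whose positivity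
  is at stake.\<close>

lemma lin_ext_conj_ext_mult:
  "lin_ext f (conj_ext j P * Q) = (\<Sum>u\<in>Poly_Mapping.keys P. \<Sum>v\<in>Poly_Mapping.keys Q.
    cnj (Poly_Mapping.lookup P u) * Poly_Mapping.lookup Q v * f (j u + v))"
proof -
  have "conj_ext j P * Q = (\<Sum>u\<in>Poly_Mapping.keys P. \<Sum>v\<in>Poly_Mapping.keys Q.
      Poly_Mapping.single (j u + v) (cnj (Poly_Mapping.lookup P u) * Poly_Mapping.lookup Q v))"
  proof -
    have "conj_ext j P * Q = conj_ext j P *
        (\<Sum>v\<in>Poly_Mapping.keys Q. Poly_Mapping.single v (Poly_Mapping.lookup Q v))"
      by (simp add: poly_mapping_sum_single)
    then show ?thesis
      by (simp add: conj_ext_def sum_product mult_single)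
  qed
  then show ?thesis
    by (simp add: lin_ext_sum)
qed

section \<open>Transposition length and invariant colourings\<close>

text \<open>For \<open>p\<close> permuting \<open>{1..N}\<close> these are the colourings that are
  constant on the cycles of \<open>p\<close>, so their number is \<open>d\<close> to the number of
  cycles in \<open>{1..N}\<close>, fixed points included. Cardinalities of this set replace cycle
  counts throughout.\<close>

definition fixed_colourings :: "nat \<Rightarrow> nat \<Rightarrow> (nat \<Rightarrow> nat) \<Rightarrow> (nat \<Rightarrow> nat) set" where
  "fixed_colourings d N p = {f \<in> {1..N} \<rightarrow>\<^sub>E {..<d}. f \<circ> p = f}"

lemma fixed_colourings_iff:
  "f \<in> fixed_colourings d N p \<longleftrightarrow> f \<in> {1..N} \<rightarrow>\<^sub>E {..<d} \<and> (\<forall>x. f (p x) = f x)"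
  by (simp add: fixed_colourings_def fun_eq_iff)

lemma finite_fixed_colourings [simp]: "finite (fixed_colourings d N p)"
  unfolding fixed_colourings_def
  by (rule finite_subset[of _ "{1..N} \<rightarrow>\<^sub>E {..<d}"]) (auto intro: finite_PiE)

lemma card_fixed_colourings_id: "card (fixed_colourings d N id) = d ^ N"
  by (simp add: fixed_colourings_def card_PiE)

lemma comp_permutes_PiE:
  assumes "p permutes A" and "f \<in> A \<rightarrow>\<^sub>E B"
  shows "f \<circ> p \<in> A \<rightarrow>\<^sub>E B"
proof (rule PiE_I)
  fix x assume "x \<in> A"
  with assms show "(f \<circ> p) x \<in> B"
    by (auto simp: permutes_in_image)
next
  fix x assume "x \<notin> A"
  then show "(f \<circ> p) x = undefined"
    using assms by (simp add: permutes_not_in[OF assms(1)] PiE_arb[OF assms(2)])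
qed

text \<open>Composing with the transposition makes \<open>a\<close> a fixed point and shortens its
  former cycle, which still contains \<open>b\<close>. The colour of \<open>a\<close> becomes free
  while the other points keep their constraints, whence the factor \<open>d\<close>.\<close>

lemma card_fixed_colourings_transpose:
  assumes p: "p permutes {1..N}" and a: "a \<in> {1..N}" and ab: "p a = b" "a \<noteq> b"
  shows "card (fixed_colourings d N (Transposition.transpose a b \<circ> p)) =
    d * card (fixed_colourings d N p)"
proof -
  let ?q = "Transposition.transpose a b \<circ> p"
  have b: "b \<in> {1..N}"
    using p a ab permutes_in_image by metis
  have inj: "p x = p y \<longleftrightarrow> x = y" for x y
    using permutes_inj[OF p] by (auto dest: injD)
  have "bij_betw (\<lambda>(c, f). f(a := c)) ({..<d} \<times> fixed_colourings d N p)
    (fixed_colourings d N ?q)"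
  \<comment> \<open>A colouring invariant under \<open>p\<close> agrees at \<open>a\<close> and
    \<open>b\<close>, so overwriting the value at \<open>a\<close> by \<open>g b\<close> undoes the
    free choice of colour.\<close>
  proof (rule bij_betwI[where g = "\<lambda>g. (g a, g(a := g b))"])
    show "(\<lambda>(c, f). f(a := c)) \<in> {..<d} \<times> fixed_colourings d N p \<rightarrow> fixed_colourings d N ?q"
    proof (rule funcsetI)
      fix z assume "z \<in> {..<d} \<times> fixed_colourings d N p"
      then obtain c f where z: "z = (c, f)" and c: "c < d" and f: "f \<in> {1..N} \<rightarrow>\<^sub>E {..<d}"
        and fp: "\<forall>x. f (p x) = f x"
        by (cases z) (simp add: fixed_colourings_iff)
      have "f(a := c) \<in> {1..N} \<rightarrow>\<^sub>E {..<d}"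
        using c f a by (auto simp: PiE_iff extensional_def)
      moreover have "(f(a := c)) (?q x) = (f(a := c)) x" for x
      proof -
        have "f b = f a"
          using fp[rule_format, of a] ab(1) by simp
        moreover have "p x = b \<longleftrightarrow> x = a"
          using inj[of x a] ab(1) by simp
        ultimately show ?thesis
          using fp[rule_format, of x] ab(2)
          by (cases "x = a"; cases "p x = a") (auto simp: transpose_def)
      qed
      ultimately show "(case z of (c, f) \<Rightarrow> f(a := c)) \<in> fixed_colourings d N ?q"
        by (simp add: z fixed_colourings_iff)
    qed
    show "(\<lambda>g. (g a, g(a := g b))) \<in> fixed_colourings d N ?q \<rightarrow> {..<d} \<times> fixed_colourings d N p"
    proof (rule funcsetI)
      fix g assume "g \<in> fixed_colourings d N ?q"
      then have g: "g \<in> {1..N} \<rightarrow>\<^sub>E {..<d}"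
        and gq: "\<forall>x. g (Transposition.transpose a b (p x)) = g x"
        by (simp_all add: fixed_colourings_iff)
      have "g a \<in> {..<d}" "g b \<in> {..<d}"
        using g a b by auto
      moreover from this have "g(a := g b) \<in> {1..N} \<rightarrow>\<^sub>E {..<d}"
        using g a by (auto simp: PiE_iff extensional_def)
      moreover have "(g(a := g b)) (p x) = (g(a := g b)) x" for x
      proof -
        have "p x = b \<longleftrightarrow> x = a"
          using inj[of x a] ab(1) by simp
        then show ?thesis
          using gq[rule_format, of x] ab
          by (cases "x = a"; cases "p x = a") (auto simp: transpose_def)
      qed
      ultimately show "(g a, g(a := g b)) \<in> {..<d} \<times> fixed_colourings d N p"
        by (simp add: fixed_colourings_iff)
    qed
  next
    fix x assume "x \<in> {..<d} \<times> fixed_colourings d N p"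
    then obtain c f where x: "x = (c, f)" "\<forall>x. f (p x) = f x"
      by (cases x) (simp add: fixed_colourings_iff)
    have "f b = f a"
      using x(2)[rule_format, of a] ab by simp
    then show "((case x of (c, f) \<Rightarrow> f(a := c)) a,
        (case x of (c, f) \<Rightarrow> f(a := c))(a := (case x of (c, f) \<Rightarrow> f(a := c)) b)) = x"
      using x ab by (auto simp: fun_eq_iff)
  qed auto
  then have "card ({..<d} \<times> fixed_colourings d N p) = card (fixed_colourings d N ?q)"
    by (rule bij_betw_same_card)
  then show ?thesis
    by (simp add: card_cartesian_product)
qed

text \<open>
  Two-valued fixed colourings form a group under pointwise addition modulo \<open>2\<close>, in which those
  with equal values at \<open>a\<close> and \<open>b\<close> have index at most \<open>2\<close>.
\<close>

lemma card_fixed_colourings_le_transpose: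
  assumes p: "p permutes {1..N}" and ab: "a \<in> {1..N}" "b \<in> {1..N}"
  shows "card (fixed_colourings 2 N p) \<le>
    2 * card (fixed_colourings 2 N (Transposition.transpose a b \<circ> p))"
proof -
  define E where "E = {f \<in> fixed_colourings 2 N p. f a = f b}"
  define D where "D = {f \<in> fixed_colourings 2 N p. f a \<noteq> f b}"
  have fin: "finite E" "finite D"
    by (simp_all add: E_def D_def)
  have lt: "f x < 2" if "f \<in> D" "x \<in> {1..N}" for f x
    using that PiE_mem[of f "{1..N}" "\<lambda>_. {..<2}" x] by (simp add: D_def fixed_colourings_iff)
  have out: "f x = undefined" if "f \<in> D" "x \<notin> {1..N}" for f x
    using that PiE_arb[of f "{1..N}" "\<lambda>_. {..<2}" x] by (simp add: D_def fixed_colourings_iff)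
  have fp: "f (p x) = f x" if "f \<in> D" for f x
    using that by (simp add: D_def fixed_colourings_iff)
  have "card D \<le> card E"
  proof (cases "D = {}")
    case False
    then obtain f0 where f0: "f0 \<in> D"
      by blast
    let ?s = "\<lambda>f. \<lambda>x. if x \<in> {1..N} then (f x + f0 x) mod 2 else undefined"
    show ?thesis
    proof (rule card_inj_on_le[OF _ _ fin(1)])
      show "inj_on ?s D"
      proof (rule inj_onI, rule ext)
        fix f g x
        assume f: "f \<in> D" and g: "g \<in> D" and eq: "?s f = ?s g"
        show "f x = g x"
        proof (cases "x \<in> {1..N}")
          case True
          then have "(f x + f0 x) mod 2 = (g x + f0 x) mod 2"
            using fun_cong[OF eq, of x] by simp
          with lt[OF f True] lt[OF g True] show ?thesis
            by presburger
        next
          case False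
          then show ?thesis
            using out[OF f False] out[OF g False] by simp
        qed
      qed
      show "?s ` D \<subseteq> E"
      proof (rule image_subsetI)
        fix f assume f: "f \<in> D"
        have "f a \<noteq> f b" "f0 a \<noteq> f0 b"
          using f f0 by (simp_all add: D_def)
        moreover have "f a < 2" "f b < 2" "f0 a < 2" "f0 b < 2"
          using lt f f0 ab by simp_all
        ultimately have "(f a + f0 a) mod 2 = (f b + f0 b) mod 2"
          by presburger
        moreover have "?s f \<in> {1..N} \<rightarrow>\<^sub>E {..<2}"
          by (rule PiE_I) auto
        moreover have "?s f (p x) = ?s f x" for x
          using permutes_in_image[OF p, of x] fp[OF f, of x] fp[OF f0, of x] by (simp del: atLeastAtMost_iff)
        ultimately show "?s f \<in> E"
          using ab by (simp add: E_def fixed_colourings_iff)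
      qed
    qed
  qed simp
  moreover have "fixed_colourings 2 N p = E \<union> D" "E \<inter> D = {}"
    by (auto simp: E_def D_def)
  ultimately have "card (fixed_colourings 2 N p) \<le> 2 * card E"
    using card_Un_disjoint[OF fin] by simp
  moreover have "E \<subseteq> fixed_colourings 2 N (Transposition.transpose a b \<circ> p)"
  proof
    fix f assume f: "f \<in> E"
    then have "f (Transposition.transpose a b y) = f y" for y
      by (simp add: E_def transpose_def)
    with f show "f \<in> fixed_colourings 2 N (Transposition.transpose a b \<circ> p)"
      by (simp add: E_def fixed_colourings_iff)
  qed
  then have "card E \<le> card (fixed_colourings 2 N (Transposition.transpose a b \<circ> p))"
    by (intro card_mono) auto
  ultimately show ?thesis
    by linarith
qed

section \<open>Transposition length as a count of invariant colourings\<close>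

lemma Rep_S_inf_add [simp]: "Rep_S_inf (\<sigma> + \<tau>) = Rep_S_inf \<sigma> \<circ> Rep_S_inf \<tau>"
  by (rule plus_S_inf.rep_eq)

lemma Rep_S_inf_zero [simp]: "Rep_S_inf 0 = id"
  by (rule zero_S_inf.rep_eq)

lemma Rep_S_inf_uminus [simp]: "Rep_S_inf (- \<sigma>) = inv (Rep_S_inf \<sigma>)"
  by (rule uminus_S_inf.rep_eq)

lemma Rep_S_inf_diff [simp]: "Rep_S_inf (\<sigma> - \<tau>) = Rep_S_inf \<sigma> \<circ> inv (Rep_S_inf \<tau>)"
  by (simp only: minus_S_inf_def Rep_S_inf_add Rep_S_inf_uminus)

lemma Rep_S_inf_permutes: "\<exists>N0. \<forall>N\<ge>N0. Rep_S_inf \<sigma> permutes {1..N}"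
proof -
  obtain k0 where p: "Rep_S_inf \<sigma> permutes {1..}" and k0: "\<forall>k>k0. Rep_S_inf \<sigma> k = k"
    using Rep_S_inf[of \<sigma>] by auto
  have "Rep_S_inf \<sigma> permutes {1..N}" if "N \<ge> k0" for N
    by (rule permutes_superset[OF p]) (use k0 that in auto)
  then show ?thesis
    by blast
qed

text \<open>Places finitely many permutations in one finite symmetric group, where colourings can be
  counted. Admitting every larger \<open>N\<close> lets two thresholds be combined by their
  maximum.\<close>

lemma Rep_S_inf_permutes_finite:
  assumes "finite S"
  shows "\<exists>N0. \<forall>N\<ge>N0. \<forall>\<sigma>\<in>S. Rep_S_inf \<sigma> permutes {1..N}"
  using assms
proof induction
  case (insert \<sigma> S)
  then obtain N0 where N0: "\<forall>N\<ge>N0. \<forall>\<sigma>\<in>S. Rep_S_inf \<sigma> permutes {1..N}"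
    by blast
  obtain N1 where N1: "\<forall>N\<ge>N1. Rep_S_inf \<sigma> permutes {1..N}"
    using Rep_S_inf_permutes by blast
  have "\<forall>N\<ge>max N0 N1. \<forall>\<tau>\<in>insert \<sigma> S. Rep_S_inf \<tau> permutes {1..N}"
    using N0 N1 by simp
  then show ?case ..
qed simp

lemma permutes_imp_S_inf:
  fixes p :: "nat \<Rightarrow> nat"
  assumes "p permutes {1..N}"
  shows "p \<in> {f. f permutes {1..} \<and> (\<exists>k0. \<forall>k>k0. f k = k)}"
proof -
  have "p permutes {1..}"
    by (rule permutes_subset[OF assms]) auto
  moreover have "\<forall>k>N. p k = k"
  proof (intro allI impI)
    fix k assume "k > N"
    then have "k \<notin> {1..N}"
      by simp
    then show "p k = k"
      by (rule permutes_not_in[OF assms])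
  qed
  ultimately show ?thesis
    by blast
qed

definition transp :: "nat \<Rightarrow> nat \<Rightarrow> S_inf" where
  "transp a b = Abs_S_inf (Transposition.transpose a b)"

lemma Rep_transp [simp]:
  assumes "a \<ge> 1" and "b \<ge> 1"
  shows "Rep_S_inf (transp a b) = Transposition.transpose a b"
  unfolding transp_def
  by (rule Abs_S_inf_inverse, rule permutes_imp_S_inf[of _ "max a b"], rule permutes_swap_id)
    (use assms in auto)

text \<open>The identity leaves all \<open>2 ^ N\<close> two-valued colourings invariant, and each
  further transposition at most halves their number. This bounds the length of every factorization
  from below.\<close>

lemma transposition_product_bound:
  assumes "\<forall>t\<in>set ts. is_transposition t \<and> Rep_S_inf t permutes {1..N}"
  shows "Rep_S_inf (sum_list ts) permutes {1..N} \<and>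
    2 ^ N \<le> 2 ^ length ts * card (fixed_colourings 2 N (Rep_S_inf (sum_list ts)))"
  using assms
proof (induction ts)
  case (Cons t ts)
  let ?p = "Rep_S_inf (sum_list ts)"
  from Cons have p: "?p permutes {1..N}"
    and IH: "2 ^ N \<le> 2 ^ length ts * card (fixed_colourings 2 N ?p)"
    by auto
  obtain a b where ab: "a \<noteq> b" and t: "Rep_S_inf t = Transposition.transpose a b"
    using Cons.prems by (auto simp: is_transposition_def)
  have "Rep_S_inf t permutes {1..N}"
    using Cons.prems by simp
  then have "a \<in> {1..N}" "b \<in> {1..N}"
    using permutes_not_in[of "Rep_S_inf t" "{1..N}"] ab t
    by (metis transpose_apply_first, metis transpose_apply_second)
  then have "card (fixed_colourings 2 N ?p) \<le>
      2 * card (fixed_colourings 2 N (Transposition.transpose a b \<circ> ?p))"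
    by (rule card_fixed_colourings_le_transpose[OF p])
  then have "2 ^ length ts * card (fixed_colourings 2 N ?p) \<le>
      2 ^ length ts * (2 * card (fixed_colourings 2 N (Transposition.transpose a b \<circ> ?p)))"
    by (rule mult_le_mono2)
  from order.trans[OF IH this] have "2 ^ N \<le>
      2 ^ length (t # ts) * card (fixed_colourings 2 N (Transposition.transpose a b \<circ> ?p))"
    by (simp add: mult_ac)
  moreover have "Rep_S_inf (sum_list (t # ts)) = Transposition.transpose a b \<circ> ?p"
    by (simp add: t)
  moreover have "Transposition.transpose a b \<circ> ?p permutes {1..N}"
    using permutes_compose[OF p \<open>Rep_S_inf t permutes {1..N}\<close>] t by simp
  ultimately show ?case
    by metis
qed (simp add: card_fixed_colourings_id permutes_id)

text \<open>Multiplying by the transposition of a moved point \<open>a\<close> and its image turns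
  \<open>a\<close> into a fixed point, so induction on the size of the support builds the list. One
  list serves all \<open>d\<close> and \<open>N\<close>: its minimality is tested with two colours,
  its count is used with \<open>d\<close> colours.\<close>

lemma exists_optimal_factorization:
  "\<exists>ts. (\<forall>t\<in>set ts. is_transposition t) \<and> sum_list ts = \<sigma> \<and>
    (\<forall>d N. Rep_S_inf \<sigma> permutes {1..N} \<longrightarrow>
      d ^ length ts * card (fixed_colourings d N (Rep_S_inf \<sigma>)) = d ^ N)"
proof (induction "card {x. Rep_S_inf \<sigma> x \<noteq> x}" arbitrary: \<sigma> rule: less_induct)
  case less
  show ?case
  proof (cases "\<sigma> = 0")
    case True
    then show ?thesis
      by (intro exI[of _ "[]"]) (simp add: card_fixed_colourings_id)
  next
    case False
    let ?p = "Rep_S_inf \<sigma>"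
    obtain M where M: "?p permutes {1..M}"
      using Rep_S_inf_permutes by blast
    obtain a where a: "?p a \<noteq> a"
      using False by (metis Rep_S_inf_inject Rep_S_inf_zero eq_id_iff)
    define b where "b = ?p a"
    have "a \<in> {1..M}"
      using a permutes_not_in[OF M] by blast
    moreover from this have "b \<in> {1..M}"
      using permutes_in_image[OF M] by (simp add: b_def)
    ultimately have ab: "a \<ge> 1" "b \<ge> 1" "a \<noteq> b"
      using a by (auto simp: b_def)
    define \<rho> where "\<rho> = transp a b + \<sigma>"
    have Rep: "Rep_S_inf \<rho> = Transposition.transpose a b \<circ> ?p"
      using ab by (simp add: \<rho>_def)
    \<comment> \<open>A fixed point of \<open>?p\<close> is mapped neither to \<open>a\<close> nor
      to \<open>b\<close>, so it stays fixed, and \<open>a\<close> becomes a new fixed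
      point.\<close>
    have "{x. Rep_S_inf \<rho> x \<noteq> x} \<subset> {x. ?p x \<noteq> x}"
    proof
      have "?p x \<noteq> a" if "?p x = x" for x
        using that a by auto
      moreover have "?p x \<noteq> b" if "?p x = x" for x
        using that a permutes_inj[OF M] by (auto simp: b_def dest: injD)
      ultimately show "{x. Rep_S_inf \<rho> x \<noteq> x} \<subseteq> {x. ?p x \<noteq> x}"
        by (auto simp: Rep)
      show "{x. Rep_S_inf \<rho> x \<noteq> x} \<noteq> {x. ?p x \<noteq> x}"
        using a by (auto simp: Rep b_def set_eq_iff intro!: exI[of _ a])
    qed
    moreover have "finite {x. ?p x \<noteq> x}"
      by (rule finite_subset[of _ "{1..M}"]) (use permutes_not_in[OF M] in blast, simp)
    ultimately have "card {x. Rep_S_inf \<rho> x \<noteq> x} < card {x. ?p x \<noteq> x}"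
      by (rule psubset_card_mono[rotated])
    from less[OF this] obtain ts where ts: "\<forall>t\<in>set ts. is_transposition t" "sum_list ts = \<rho>"
      and card: "\<And>d N. Rep_S_inf \<rho> permutes {1..N} \<Longrightarrow>
        d ^ length ts * card (fixed_colourings d N (Rep_S_inf \<rho>)) = d ^ N"
      by blast
    have "is_transposition (transp a b)"
      using ab by (auto simp: is_transposition_def)
    moreover have "transp a b + \<rho> = \<sigma>"
      by (rule Rep_S_inf_inject[THEN iffD1]) (use ab in \<open>simp add: Rep fun_eq_iff\<close>)
    moreover have "d ^ length (transp a b # ts) * card (fixed_colourings d N ?p) = d ^ N"
      if N: "?p permutes {1..N}" for d N
    proof -
      have a': "a \<in> {1..N}"
        using a permutes_not_in[OF N] by blast
      then have "b \<in> {1..N}"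
        using permutes_in_image[OF N] by (simp add: b_def)
      with a' have "Rep_S_inf \<rho> permutes {1..N}"
        unfolding Rep by (intro permutes_compose[OF N] permutes_swap_id)
      from card[OF this, of d] show ?thesis
        using card_fixed_colourings_transpose[OF N a' b_def[symmetric] ab(3), of d]
        by (simp add: Rep mult_ac)
    qed
    ultimately show ?thesis
      using ts by (intro exI[of _ "transp a b # ts"]) auto
  qed
qed

text \<open>The list from \<open>exists_optimal_factorization\<close> is minimal: for any competitor
  \<open>us\<close>, the exact two-colour count for that list meets the lower bound for
  \<open>us\<close> in a common \<open>{1..M}\<close>. For \<open>d \<ge> 1\<close> the equation
  says that \<open>phi d\<close> of a permutation is its proportion of invariant colourings.\<close>

lemma transp_length_fixed_colourings:
  assumes "Rep_S_inf \<sigma> permutes {1..N}"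
  shows "d ^ transp_length \<sigma> * card (fixed_colourings d N (Rep_S_inf \<sigma>)) = d ^ N"
proof -
  obtain ts where ts: "\<forall>t\<in>set ts. is_transposition t" "sum_list ts = \<sigma>"
    and card: "\<And>d N. Rep_S_inf \<sigma> permutes {1..N} \<Longrightarrow>
      d ^ length ts * card (fixed_colourings d N (Rep_S_inf \<sigma>)) = d ^ N"
    using exists_optimal_factorization by blast
  have "transp_length \<sigma> = length ts"
    unfolding transp_length_def
  proof (rule Least_equality)
    show "\<exists>us. length us = length ts \<and> (\<forall>t\<in>set us. is_transposition t) \<and> sum_list us = \<sigma>"
      using ts by blast
  next
    fix n
    assume "\<exists>us. length us = n \<and> (\<forall>t\<in>set us. is_transposition t) \<and> sum_list us = \<sigma>"
    then obtain us where us: "length us = n" "\<forall>t\<in>set us. is_transposition t" "sum_list us = \<sigma>"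
      by blast
    obtain M where M: "\<forall>t\<in>set us. Rep_S_inf t permutes {1..M}"
      using Rep_S_inf_permutes_finite[of "set us"] by auto
    let ?c = "card (fixed_colourings 2 M (Rep_S_inf \<sigma>))"
    have "Rep_S_inf \<sigma> permutes {1..M}" and le: "2 ^ M \<le> 2 ^ n * ?c"
      using transposition_product_bound[of us M] us M by auto
    then have eq: "2 ^ length ts * ?c = 2 ^ M"
      using card by blast
    then have "?c > 0"
      by (metis gr0I mult_0_right power_not_zero zero_neq_numeral)
    moreover have "2 ^ length ts * ?c \<le> 2 ^ n * ?c"
      using eq le by simp
    ultimately have "(2::nat) ^ length ts \<le> 2 ^ n"
      by simp
    then show "length ts \<le> n"
      by (simp only: power_increasing_iff[of "2::nat"] one_less_numeral_iff semiring_norm)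
  qed
  with card[OF assms] show ?thesis
    by simp
qed

lemma card_fixed_colourings_conj:
  assumes s: "s permutes {1..N}"
  shows "card (fixed_colourings d N (s \<circ> p \<circ> inv s)) = card (fixed_colourings d N p)"
proof (rule bij_betw_same_card, rule bij_betwI[where f = "\<lambda>f. f \<circ> s" and g = "\<lambda>f. f \<circ> inv s"])
  have inv: "inv s permutes {1..N}"
    by (rule permutes_inv[OF s])
  have s_inv: "inv s (s x) = x" "s (inv s x) = x" for x
    using permutes_inverses[OF s] by auto
  show "(\<lambda>f. f \<circ> s) \<in> fixed_colourings d N (s \<circ> p \<circ> inv s) \<rightarrow> fixed_colourings d N p"
  proof (rule funcsetI)
    fix f assume "f \<in> fixed_colourings d N (s \<circ> p \<circ> inv s)"
    then have f: "f \<in> {1..N} \<rightarrow>\<^sub>E {..<d}" "f (s (p (inv s x))) = f x" for x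
      by (simp_all add: fixed_colourings_iff)
    have "f (s (p x)) = f (s x)" for x
      using f(2)[of "s x"] by (simp add: s_inv)
    then show "f \<circ> s \<in> fixed_colourings d N p"
      using comp_permutes_PiE[OF s f(1)] by (simp add: fixed_colourings_iff)
  qed
  show "(\<lambda>f. f \<circ> inv s) \<in> fixed_colourings d N p \<rightarrow> fixed_colourings d N (s \<circ> p \<circ> inv s)"
    by (intro funcsetI) (simp add: fixed_colourings_iff s_inv comp_permutes_PiE[OF inv] del: One_nat_def)
  show "f \<circ> s \<circ> inv s = f" "f \<circ> inv s \<circ> s = f" for f :: "nat \<Rightarrow> nat"
    by (simp_all add: fun_eq_iff s_inv)
qed

text \<open>For both permutations the power \<open>2 ^ transp_length\<close> times the two-colour
  count equals \<open>2 ^ N\<close>, so a ratio of counts is a difference of lengths.\<close>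

lemma transp_length_eqI:
  assumes "Rep_S_inf \<sigma> permutes {1..N}" and "Rep_S_inf \<tau> permutes {1..N}"
    and "card (fixed_colourings 2 N (Rep_S_inf \<sigma>)) =
      2 ^ k * card (fixed_colourings 2 N (Rep_S_inf \<tau>))"
  shows "transp_length \<tau> = transp_length \<sigma> + k"
proof -
  let ?c = "card (fixed_colourings 2 N (Rep_S_inf \<tau>))"
  have \<tau>: "2 ^ transp_length \<tau> * ?c = 2 ^ N"
    by (rule transp_length_fixed_colourings[OF assms(2)])
  then have "?c > 0"
    by (metis gr0I mult_0_right power_not_zero zero_neq_numeral)
  moreover have "2 ^ transp_length \<tau> * ?c = 2 ^ (transp_length \<sigma> + k) * ?c"
    using \<tau> transp_length_fixed_colourings[OF assms(1), of 2] assms(3)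
    by (simp add: power_add mult_ac)
  ultimately have "(2::nat) ^ transp_length \<tau> = 2 ^ (transp_length \<sigma> + k)"
    by (simp add: card_gt_0_iff)
  then show ?thesis
    by (rule power_inject_exp[THEN iffD1, rotated]) simp
qed

section \<open>Conjugation invariance of the length, and positivity and trace property of
  \<open>phi\<close>\<close>

lemma transp_length_conj: "transp_length (\<sigma> + \<rho> - \<sigma>) = transp_length \<rho>"
proof -
  obtain N where N: "\<forall>\<tau>\<in>{\<sigma>, \<rho>, \<sigma> + \<rho> - \<sigma>}. Rep_S_inf \<tau> permutes {1..N}"
    using Rep_S_inf_permutes_finite[of "{\<sigma>, \<rho>, \<sigma> + \<rho> - \<sigma>}"] by blast
  then have "transp_length \<rho> = transp_length (\<sigma> + \<rho> - \<sigma>) + 0"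
    using card_fixed_colourings_conj[of "Rep_S_inf \<sigma>" N 2 "Rep_S_inf \<rho>"]
    by (intro transp_length_eqI[of _ N]) (auto simp: o_assoc)
  then show ?thesis
    by simp
qed

text \<open>The two products are conjugate by \<open>\<sigma>\<close>. This is the source of the
  trace property \<open>phi_commute\<close>.\<close>

lemma transp_length_commute: "transp_length (\<sigma> + \<tau>) = transp_length (\<tau> + \<sigma>)"
proof -
  have "\<sigma> + (\<tau> + \<sigma>) - \<sigma> = \<sigma> + \<tau>"
    by (simp add: add.assoc[symmetric])
  then show ?thesis
    using transp_length_conj[of \<sigma> "\<tau> + \<sigma>"] by simp
qed

text \<open>The transposition inserts the fixed point \<open>b\<close> into the cycle of
  \<open>1\<close>. Read backwards, the product sends \<open>b\<close> to \<open>1\<close>, and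
  composing with the transposition once more restores \<open>\<rho>\<close>, so
  \<open>card_fixed_colourings_transpose\<close> applies with \<open>b\<close> as the point split
  off.\<close>

lemma transp_length_fresh_transp:
  assumes fixed: "Rep_S_inf \<rho> b = b" and b: "b > 1"
  shows "transp_length (transp 1 b + \<rho>) = Suc (transp_length \<rho>)"
proof -
  let ?\<sigma> = "transp 1 b + \<rho>"
  obtain N where N: "Rep_S_inf \<rho> permutes {1..N}" "Rep_S_inf ?\<sigma> permutes {1..N}" "N \<ge> b"
    using Rep_S_inf_permutes_finite[of "{\<rho>, ?\<sigma>}"] by (metis finite.simps insertCI nle_le)
  have "Rep_S_inf ?\<sigma> b = 1"
    using fixed b by simp
  moreover have "Transposition.transpose b 1 \<circ> Rep_S_inf ?\<sigma> = Rep_S_inf \<rho>"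
    using b by (simp add: fun_eq_iff transpose_commute[of b "Suc 0"])
  ultimately have "card (fixed_colourings 2 N (Rep_S_inf \<rho>)) =
      2 ^ 1 * card (fixed_colourings 2 N (Rep_S_inf ?\<sigma>))"
    using card_fixed_colourings_transpose[OF N(2), of b 1 2] b N(3) by simp
  then show ?thesis
    using transp_length_eqI[OF N(1,2), of 1] by simp
qed

text \<open>Substituting \<open>f \<circ> inv s\<close> for \<open>f\<close> separates the two
  permutations. The right side counts coincidences of \<open>f \<circ> s\<close> and
  \<open>f \<circ> t\<close>, which is an inner product of two 0-1 matrices.\<close>

lemma card_fixed_colourings_inv_comp:
  assumes s: "s permutes {1..N}" and t: "t permutes {1..N}"
  shows "card (fixed_colourings d N (inv s \<circ> t)) =
    card {f \<in> {1..N} \<rightarrow>\<^sub>E {..<d}. f \<circ> s = f \<circ> t}"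
proof (rule bij_betw_same_card, rule bij_betwI[where f = "\<lambda>f. f \<circ> inv s" and g = "\<lambda>f. f \<circ> s"])
  have s_inv: "inv s (s x) = x" "s (inv s x) = x" for x
    using permutes_inverses[OF s] by auto
  show "(\<lambda>f. f \<circ> inv s) \<in> fixed_colourings d N (inv s \<circ> t) \<rightarrow>
      {f \<in> {1..N} \<rightarrow>\<^sub>E {..<d}. f \<circ> s = f \<circ> t}"
  proof (rule funcsetI)
    fix f assume "f \<in> fixed_colourings d N (inv s \<circ> t)"
    then have f: "f \<in> {1..N} \<rightarrow>\<^sub>E {..<d}" "f (inv s (t x)) = f x" for x
      by (simp_all add: fixed_colourings_iff)
    then show "f \<circ> inv s \<in> {f \<in> {1..N} \<rightarrow>\<^sub>E {..<d}. f \<circ> s = f \<circ> t}"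
      using comp_permutes_PiE[OF permutes_inv[OF s] f(1)] by (simp add: s_inv fun_eq_iff)
  qed
  show "(\<lambda>f. f \<circ> s) \<in> {f \<in> {1..N} \<rightarrow>\<^sub>E {..<d}. f \<circ> s = f \<circ> t} \<rightarrow>
      fixed_colourings d N (inv s \<circ> t)"
  proof (rule funcsetI)
    fix f assume "f \<in> {f \<in> {1..N} \<rightarrow>\<^sub>E {..<d}. f \<circ> s = f \<circ> t}"
    then have f: "f \<in> {1..N} \<rightarrow>\<^sub>E {..<d}" "f (s x) = f (t x)" for x
      by (simp_all add: fun_eq_iff)
    then show "f \<circ> s \<in> fixed_colourings d N (inv s \<circ> t)"
      using comp_permutes_PiE[OF s f(1)] by (simp add: fixed_colourings_iff s_inv)
  qed
  show "f \<circ> inv s \<circ> s = f" "f \<circ> s \<circ> inv s = f" for f :: "nat \<Rightarrow> nat"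
    by (simp_all add: fun_eq_iff s_inv)
qed

text \<open>
  The form \<open>(\<sigma>, \<tau>) \<mapsto> \<phi>(\<sigma>\<^sup>* \<tau>)\<close> is the Gram form of the vectors
  \<open>f \<mapsto> f \<circ> \<sigma>\<close> in the permutation action on colourings, so it is positive semidefinite.
\<close>

lemma phi_positive:
  assumes d: "d \<ge> 1"
  shows "phi d (conj_ext uminus Q * Q) \<in> \<real>\<^sub>\<ge>\<^sub>0"
proof -
  let ?K = "Poly_Mapping.keys Q" and ?q = "Poly_Mapping.lookup Q"
  obtain N where N: "\<forall>\<sigma>\<in>?K. Rep_S_inf \<sigma> permutes {1..N}"
    using Rep_S_inf_permutes_finite[of ?K] by auto
  let ?F = "{1..N} \<rightarrow>\<^sub>E {..<d}"
  \<comment> \<open>The entry at \<open>(f, h)\<close> of the matrix by which \<open>Q\<close> acts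
    on colourings. After the sums are interchanged, the value of \<open>phi\<close> is the squared
    Hilbert-Schmidt norm of this matrix divided by \<open>d ^ N\<close>.\<close>
  let ?z = "\<lambda>f h. \<Sum>\<sigma>\<in>?K. ?q \<sigma> * of_bool (f \<circ> Rep_S_inf \<sigma> = h)"
  have fin: "finite ?F"
    by (simp add: finite_PiE)
  have cnj_of_bool: "cnj (of_bool P) = of_bool P" for P
    by (cases P) simp_all
  have gram: "(1 / of_nat d) ^ transp_length (- \<sigma> + \<tau>) =
      (1 / of_nat d ^ N :: complex) * (\<Sum>f\<in>?F. \<Sum>h\<in>?F.
        of_bool (f \<circ> Rep_S_inf \<sigma> = h) * of_bool (f \<circ> Rep_S_inf \<tau> = h))"
    if \<sigma>\<tau>: "\<sigma> \<in> ?K" "\<tau> \<in> ?K" for \<sigma> \<tau>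
  proof -
    let ?s = "Rep_S_inf \<sigma>" and ?t = "Rep_S_inf \<tau>"
    have s: "?s permutes {1..N}" and t: "?t permutes {1..N}"
      using N \<sigma>\<tau> by auto
    have st: "Rep_S_inf (- \<sigma> + \<tau>) permutes {1..N}"
      using permutes_compose[OF t permutes_inv[OF s]] by simp
    have "(\<Sum>f\<in>?F. \<Sum>h\<in>?F. of_bool (f \<circ> ?s = h) * of_bool (f \<circ> ?t = h)) =
        (\<Sum>f\<in>?F. of_bool (f \<circ> ?s = f \<circ> ?t) :: complex)"
    proof (rule sum.cong[OF refl])
      fix f assume "f \<in> ?F"
      then have "f \<circ> ?s \<in> ?F"
        by (rule comp_permutes_PiE[OF s])
      have "(\<Sum>h\<in>?F. of_bool (f \<circ> ?s = h) * of_bool (f \<circ> ?t = h)) =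
          (\<Sum>h\<in>?F. if f \<circ> ?s = h then of_bool (f \<circ> ?s = f \<circ> ?t) else 0 :: complex)"
        by (rule sum.cong) auto
      then show "(\<Sum>h\<in>?F. of_bool (f \<circ> ?s = h) * of_bool (f \<circ> ?t = h)) =
          (of_bool (f \<circ> ?s = f \<circ> ?t) :: complex)"
        using fin \<open>f \<circ> ?s \<in> ?F\<close> by simp
    qed
    also have "\<dots> = of_nat (card {f \<in> ?F. f \<circ> ?s = f \<circ> ?t})"
      using fin by (simp add: of_bool_def sum.If_cases Int_def)
    also have "\<dots> = of_nat (card (fixed_colourings d N (Rep_S_inf (- \<sigma> + \<tau>))))"
      using card_fixed_colourings_inv_comp[OF s t] by simp
    also have "\<dots> = of_nat d ^ N * (1 / of_nat d) ^ transp_length (- \<sigma> + \<tau>)"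
    proof -
      have "of_nat d ^ transp_length (- \<sigma> + \<tau>) *
          of_nat (card (fixed_colourings d N (Rep_S_inf (- \<sigma> + \<tau>)))) = (of_nat d ^ N :: complex)"
        using arg_cong[OF transp_length_fixed_colourings[OF st, of d], of of_nat] by simp
      then show ?thesis
        using d by (simp add: power_divide field_simps)
    qed
    finally show ?thesis
      using d by simp
  qed
  have "phi d (conj_ext uminus Q * Q) =
      (\<Sum>\<sigma>\<in>?K. \<Sum>\<tau>\<in>?K. cnj (?q \<sigma>) * ?q \<tau> * ((1 / of_nat d ^ N :: complex) *
        (\<Sum>f\<in>?F. \<Sum>h\<in>?F. of_bool (f \<circ> Rep_S_inf \<sigma> = h) * of_bool (f \<circ> Rep_S_inf \<tau> = h))))"
    unfolding phi_def lin_ext_conj_ext_mult by (intro sum.cong refl) (simp only: gram)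
  also have "\<dots> = (1 / of_nat d ^ N) * (\<Sum>\<sigma>\<in>?K. \<Sum>\<tau>\<in>?K. \<Sum>f\<in>?F. \<Sum>h\<in>?F.
      (cnj (?q \<sigma>) * of_bool (f \<circ> Rep_S_inf \<sigma> = h)) * (?q \<tau> * of_bool (f \<circ> Rep_S_inf \<tau> = h)))"
    by (simp only: sum_distrib_left mult_ac)
  also have "(\<Sum>\<sigma>\<in>?K. \<Sum>\<tau>\<in>?K. \<Sum>f\<in>?F. \<Sum>h\<in>?F.
      (cnj (?q \<sigma>) * of_bool (f \<circ> Rep_S_inf \<sigma> = h)) * (?q \<tau> * of_bool (f \<circ> Rep_S_inf \<tau> = h))) =
      (\<Sum>\<sigma>\<in>?K. \<Sum>f\<in>?F. \<Sum>\<tau>\<in>?K. \<Sum>h\<in>?F.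
      (cnj (?q \<sigma>) * of_bool (f \<circ> Rep_S_inf \<sigma> = h)) * (?q \<tau> * of_bool (f \<circ> Rep_S_inf \<tau> = h)))"
    by (intro sum.cong refl sum.swap)
  also have "\<dots> = (\<Sum>f\<in>?F. \<Sum>\<sigma>\<in>?K. \<Sum>\<tau>\<in>?K. \<Sum>h\<in>?F.
      (cnj (?q \<sigma>) * of_bool (f \<circ> Rep_S_inf \<sigma> = h)) * (?q \<tau> * of_bool (f \<circ> Rep_S_inf \<tau> = h)))"
    by (rule sum.swap)
  also have "\<dots> = (\<Sum>f\<in>?F. \<Sum>\<sigma>\<in>?K. \<Sum>h\<in>?F. \<Sum>\<tau>\<in>?K.
      (cnj (?q \<sigma>) * of_bool (f \<circ> Rep_S_inf \<sigma> = h)) * (?q \<tau> * of_bool (f \<circ> Rep_S_inf \<tau> = h)))"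
    by (intro sum.cong refl sum.swap)
  also have "\<dots> = (\<Sum>f\<in>?F. \<Sum>h\<in>?F. \<Sum>\<sigma>\<in>?K. \<Sum>\<tau>\<in>?K.
      (cnj (?q \<sigma>) * of_bool (f \<circ> Rep_S_inf \<sigma> = h)) * (?q \<tau> * of_bool (f \<circ> Rep_S_inf \<tau> = h)))"
    by (intro sum.cong refl sum.swap)
  also have "\<dots> = (\<Sum>f\<in>?F. \<Sum>h\<in>?F. cnj (?z f h) * ?z f h)"
    by (intro sum.cong refl) (simp only: cnj_sum complex_cnj_mult sum_product cnj_of_bool)
  also have "\<dots> = complex_of_real (\<Sum>f\<in>?F. \<Sum>h\<in>?F. (cmod (?z f h))\<^sup>2)"
    by (simp only: complex_norm_square mult.commute[of "cnj _"] of_real_sum)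
  also have "(1 / of_nat d ^ N) * \<dots> =
      complex_of_real (1 / of_nat d ^ N * (\<Sum>f\<in>?F. \<Sum>h\<in>?F. (cmod (?z f h))\<^sup>2))"
    by (simp only: of_real_mult of_real_divide of_real_power of_real_of_nat_eq of_real_1)
  also have "\<dots> \<in> \<real>\<^sub>\<ge>\<^sub>0"
    by (subst nonneg_Reals_of_real_iff) (intro mult_nonneg_nonneg sum_nonneg; simp)
  finally show ?thesis .
qed

lemma phi_commute: "phi d (A * B) = phi d (B * A)"
  unfolding phi_def lin_ext_mult
  by (subst sum.swap) (simp add: transp_length_commute mult.commute)

lemma phi_one [simp]: "phi d 1 = 1"
proof -
  have "transp_length 0 = 0"
    unfolding transp_length_def by (rule Least_equality) (auto intro!: exI[of _ "[]"])
  then show ?thesis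
    unfolding phi_def single_one[symmetric] lin_ext_single by simp
qed

section \<open>Group algebras of point stabilizers and moments with a fresh generator\<close>

definition fixing :: "nat \<Rightarrow> group_algebra set" where
  "fixing b = {A. \<forall>\<sigma>\<in>Poly_Mapping.keys A. Rep_S_inf \<sigma> b = b}"

lemma fixing_mult: "A \<in> fixing b \<Longrightarrow> B \<in> fixing b \<Longrightarrow> A * B \<in> fixing b"
  using keys_mult[of A B] by (fastforce simp: fixing_def)

lemma fixing_prod_list: "(\<And>A. A \<in> set As \<Longrightarrow> A \<in> fixing b) \<Longrightarrow> prod_list As \<in> fixing b"
proof (induction As)
  case Nil
  show ?case
    by (simp add: fixing_def)
qed (simp add: fixing_mult)

definition centred_gen :: "nat \<Rightarrow> nat \<Rightarrow> group_algebra" where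
  "centred_gen d n = star_gen n - scalar (1 / of_nat d)"

lemma star_gen_conv_transp: "star_gen n = Poly_Mapping.single (transp 1 (n + 1)) 1"
  by (simp add: star_gen_def transp_def)

lemma centred_gen_fixing:
  assumes "m \<noteq> n" and "m \<ge> 1" and "n \<ge> 1"
  shows "centred_gen d m \<in> fixing (n + 1)"
proof -
  have "Rep_S_inf (transp 1 (m + 1)) (n + 1) = n + 1"
    using assms by simp
  moreover have "Poly_Mapping.keys (centred_gen d m) \<subseteq> {transp 1 (m + 1), 0}"
    by (auto simp: centred_gen_def star_gen_conv_transp scalar_def in_keys_iff lookup_minus
        lookup_single when_def split: if_splits)
  ultimately show ?thesis
    by (auto simp: fixing_def)
qed

text \<open>Cyclicity brings the transposition in front of \<open>v + u\<close>, which fixes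
  \<open>n + 1\<close>, so the length grows by exactly one. The uncentred generator therefore
  contributes the factor \<open>1/d\<close>, and the subtracted scalar cancels it.\<close>

lemma phi_centred_gen_fresh:
  assumes A: "A \<in> fixing (n + 1)" and B: "B \<in> fixing (n + 1)" and n: "n \<ge> 1"
  shows "phi d (A * centred_gen d n * B) = 0"
proof -
  have "transp_length (u + transp 1 (n + 1) + v) = Suc (transp_length (u + v))"
    if "u \<in> Poly_Mapping.keys A" "v \<in> Poly_Mapping.keys B" for u v
  proof -
    have "transp_length (u + transp 1 (n + 1) + v) = transp_length (transp 1 (n + 1) + (v + u))"
      using transp_length_commute[of u "transp 1 (n + 1) + v"] by (simp add: add.assoc)
    also have "\<dots> = Suc (transp_length (v + u))"
      by (rule transp_length_fresh_transp) (use that A B n in \<open>auto simp: fixing_def\<close>)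
    finally show ?thesis
      by (simp add: transp_length_commute)
  qed
  then have "phi d (A * star_gen n * B) = 1 / of_nat d * phi d (A * B)"
    unfolding phi_def star_gen_conv_transp lin_ext_mult_single_mult lin_ext_mult[of _ A B] sum_distrib_left
    by (intro sum.cong refl) (simp add: mult_ac)
  moreover have "A * scalar (1 / of_nat d) * B = scalar (1 / of_nat d) * (A * B)"
    by (simp only: scalar_commute mult.assoc)
  ultimately show ?thesis
    by (simp add: centred_gen_def right_diff_distrib left_diff_distrib phi_def lin_ext_diff
        lin_ext_scalar_mult)
qed

section \<open>Exchangeability\<close>

text \<open>The remainders \<open>A \<union> B - A\<close> and \<open>A \<union> B - B\<close> have
  equal size, so any bijection between them can be glued to \<open>h\<close>.\<close>

lemma finite_bij_extends_to_permutation: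
  assumes "bij_betw h A B" and "finite A"
  obtains p where "p permutes (A \<union> B)" and "\<And>x. x \<in> A \<Longrightarrow> p x = h x"
proof -
  have "finite B" "card A = card B"
    using assms bij_betw_finite bij_betw_same_card by blast+
  then have "card (A \<union> B - A) = card (A \<union> B - B)"
    using assms(2) by (simp add: card_Diff_subset)
  then obtain g where g: "bij_betw g (A \<union> B - A) (A \<union> B - B)"
    using finite_same_card_bij[of "A \<union> B - A" "A \<union> B - B"] assms(2) \<open>finite B\<close> by auto
  define p where "p x = (if x \<in> A then h x else if x \<in> B then g x else x)" for x
  have "bij_betw p A B"
    using assms(1) by (rule bij_betw_cong[THEN iffD1, rotated]) (simp add: p_def)
  moreover have "bij_betw p (A \<union> B - A) (A \<union> B - B)"
    using g by (rule bij_betw_cong[THEN iffD1, rotated]) (auto simp: p_def)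
  ultimately have "bij_betw p (A \<union> (A \<union> B - A)) (B \<union> (A \<union> B - B))"
    by (rule bij_betw_combine) blast
  moreover have "A \<union> (A \<union> B - A) = A \<union> B" "B \<union> (A \<union> B - B) = A \<union> B"
    by blast+
  ultimately have "p permutes (A \<union> B)"
    by (intro bij_imp_permutes) (auto simp: p_def)
  then show ?thesis
    using that[of p] by (simp add: p_def)
qed

text \<open>The block of \<open>Ker i\<close> around position \<open>x\<close> is also a block of
  \<open>Ker j\<close>, and both positions lie in it. Positions in \<open>Ker\<close> start at 1 and
  list indices at 0, hence the shifts by \<open>Suc\<close>.\<close>

lemma Ker_eqD:
  assumes "Ker i = Ker j" and "length i = length j" and "x < length i" and "y < length i"
    and "i ! x = i ! y"
  shows "j ! x = j ! y"
proof -
  let ?B = "{m' \<in> {1..length i}. i ! (m' - 1) = i ! x}"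
  have "?B \<in> Ker i"
    unfolding Ker_def by (rule image_eqI[of _ _ "Suc x"]) (use assms in auto)
  then obtain m where m: "?B = {m' \<in> {1..length j}. j ! (m' - 1) = j ! (m - 1)}"
    using assms(1) by (auto simp: Ker_def)
  have "Suc x \<in> ?B" "Suc y \<in> ?B"
    using assms by auto
  then show ?thesis
    unfolding m by simp
qed

lemma partition_on_Ker: "partition_on {1..length i} (Ker i)"
  unfolding partition_on_def disjoint_def
proof (intro conjI)
  show "\<forall>p\<in>Ker i. \<forall>q\<in>Ker i. p \<noteq> q \<longrightarrow> p \<inter> q = {}"
    by (auto simp: Ker_def)
qed (auto simp: Ker_def)

lemma Ker_block_eq:
  assumes "B \<in> Ker i" and "Suc x \<in> B" and "Suc y \<in> B"
  shows "i ! x = i ! y"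
  using assms by (auto simp: Ker_def)

lemma prod_list_map_conj:
  fixes U V :: "'a::monoid_mult"
  assumes "U * V = 1" and "V * U = 1"
  shows "prod_list (map (\<lambda>a. U * X a * V) w) = U * prod_list (map X w) * V"
proof (induction w)
  case (Cons a w)
  have "U * X a * V * (U * prod_list (map X w) * V) = U * X a * (V * U) * prod_list (map X w) * V"
    by (simp only: mult.assoc)
  then show ?case
    using Cons.IH assms by (simp add: mult.assoc)
qed (simp add: assms)

text \<open>Conjugating a transposition relabels the two points it exchanges. Here \<open>1\<close>
  is kept and \<open>m + 1\<close> becomes \<open>n + 1\<close>, while scalars are central.\<close>

lemma centred_gen_conj:
  assumes \<sigma>: "Rep_S_inf \<sigma> 1 = 1" "Rep_S_inf \<sigma> (m + 1) = n + 1" and "m \<ge> 1" "n \<ge> 1"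
  shows "Poly_Mapping.single \<sigma> 1 * centred_gen d m * Poly_Mapping.single (- \<sigma>) 1 = centred_gen d n"
proof -
  let ?p = "Rep_S_inf \<sigma>"
  have "bij ?p"
    using Rep_S_inf_permutes[of \<sigma>] permutes_bij by blast
  have "?p (Transposition.transpose 1 (m + 1) (inv ?p x)) = Transposition.transpose 1 (n + 1) x" for x
  proof -
    have "?p (inv ?p x) = x"
      using \<open>bij ?p\<close> by (simp add: bij_is_surj surj_f_inv_f)
    moreover have "?p y = ?p z \<longleftrightarrow> y = z" for y z
      using \<open>bij ?p\<close> by (simp add: bij_is_inj inj_eq)
    ultimately show ?thesis
      using \<sigma> by (metis transpose_apply_first transpose_apply_other transpose_apply_second)
  qed
  then have "\<sigma> + transp 1 (m + 1) + - \<sigma> = transp 1 (n + 1)"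
    by (intro Rep_S_inf_inject[THEN iffD1]) (simp add: fun_eq_iff)
  then have "Poly_Mapping.single \<sigma> 1 * star_gen m * Poly_Mapping.single (- \<sigma>) 1 = star_gen n"
    by (simp only: star_gen_conv_transp mult_single mult_1_right)
  moreover have "Poly_Mapping.single \<sigma> 1 * scalar c * Poly_Mapping.single (- \<sigma>) 1 = scalar c" for c
    by (simp add: scalar_def mult_single)
  ultimately show ?thesis
    by (simp add: centred_gen_def right_diff_distrib left_diff_distrib)
qed

text \<open>Equal kernels make the assignment of \<open>j ! x\<close> to \<open>i ! x\<close> a
  bijection of letters. Extended to a permutation fixing \<open>1\<close>, it conjugates one product
  into the other, and the trace \<open>phi\<close> does not see conjugation.\<close>

lemma phi_centred_gen_exchangeable:
  assumes len: "length i = length j" and ker: "Ker i = Ker j"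
    and ij: "set i \<subseteq> {1..}" "set j \<subseteq> {1..}"
  shows "phi d (prod_list (map (centred_gen d) i)) = phi d (prod_list (map (centred_gen d) j))"
proof -
  have eq: "i ! x = i ! y \<longleftrightarrow> j ! x = j ! y" if "x < length i" "y < length i" for x y
    using Ker_eqD[OF ker len that] Ker_eqD[OF ker[symmetric] len[symmetric], of x y] that len
    by metis
  \<comment> \<open>Domain and range are shifted by one because the generator with index
    \<open>n\<close> moves the point \<open>n + 1\<close>. The position picked by
    \<open>SOME\<close> does not matter, by \<open>eq\<close>.\<close>
  define h where "h a = Suc (j ! (SOME x. x < length i \<and> Suc (i ! x) = a))" for a
  have h: "h (Suc (i ! x)) = Suc (j ! x)" if x: "x < length i" for x
  proof -
    let ?y = "SOME y. y < length i \<and> Suc (i ! y) = Suc (i ! x)"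
    have "?y < length i \<and> Suc (i ! ?y) = Suc (i ! x)"
      by (rule someI[of _ x]) (use x in simp)
    then show ?thesis
      using eq[of ?y x] x by (simp add: h_def)
  qed
  have "inj_on h (Suc ` set i)"
  proof (rule inj_onI)
    fix a b assume "a \<in> Suc ` set i" "b \<in> Suc ` set i" and hab: "h a = h b"
    then obtain x y where "x < length i" "a = Suc (i ! x)" "y < length i" "b = Suc (i ! y)"
      by (auto simp: in_set_conv_nth)
    then show "a = b"
      using hab h eq by auto
  qed
  moreover have "h ` Suc ` set i = Suc ` set j"
  proof -
    have set_conv: "set u = (!) u ` {0..<length u}" for u :: "nat list"
      using nth_image[of "length u" u] by simp
    have "h ` Suc ` set i = (\<lambda>x. h (Suc (i ! x))) ` {0..<length i}"
      by (simp only: set_conv[of i] image_image)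
    also have "\<dots> = (\<lambda>x. Suc (j ! x)) ` {0..<length j}"
      using h len by (intro image_cong) auto
    also have "\<dots> = Suc ` set j"
      by (simp only: set_conv[of j] image_image)
    finally show ?thesis .
  qed
  ultimately have "bij_betw h (Suc ` set i) (Suc ` set j)"
    by (simp add: bij_betw_def)
  then obtain p where p: "p permutes (Suc ` set i \<union> Suc ` set j)"
    and ph: "\<And>a. a \<in> Suc ` set i \<Longrightarrow> p a = h a"
    by (rule finite_bij_extends_to_permutation) auto
  define N where "N = Max (insert 1 (Suc ` set i \<union> Suc ` set j))"
  have "p permutes {1..N}"
    by (rule permutes_subset[OF p]) (auto simp: N_def)
  then have Rep: "Rep_S_inf (Abs_S_inf p) = p"
    by (intro Abs_S_inf_inverse permutes_imp_S_inf)
  \<comment> \<open>The letters are at least 1, so after the shift the points that \<open>p\<close>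
    may move are at least 2.\<close>
  have p1: "p 1 = 1"
    by (rule permutes_not_in[OF p]) (use ij in auto)
  let ?U = "Poly_Mapping.single (Abs_S_inf p) (1::complex)"
  let ?V = "Poly_Mapping.single (- Abs_S_inf p) (1::complex)"
  have UV: "?U * ?V = 1" "?V * ?U = 1"
    by (simp_all add: mult_single)
  have "map (centred_gen d) j = map (\<lambda>a. ?U * centred_gen d a * ?V) i"
  proof (rule nth_equalityI)
    fix x assume "x < length (map (centred_gen d) j)"
    then have x: "x < length i" "x < length j"
      using len by auto
    then have "i ! x \<ge> 1" "j ! x \<ge> 1"
      using ij nth_mem by fastforce+
    moreover have "p (i ! x + 1) = j ! x + 1"
      using ph[of "Suc (i ! x)"] h x by simp
    ultimately show "map (centred_gen d) j ! x = map (\<lambda>a. ?U * centred_gen d a * ?V) i ! x"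
      using centred_gen_conj[of "Abs_S_inf p" "i ! x" "j ! x" d] x p1 by (simp add: Rep)
  qed (simp add: len)
  then have "prod_list (map (centred_gen d) j) = ?U * (prod_list (map (centred_gen d) i) * ?V)"
    using prod_list_map_conj[OF UV] by (simp add: mult.assoc)
  then have "phi d (prod_list (map (centred_gen d) j)) =
      phi d (prod_list (map (centred_gen d) i) * ?V * ?U)"
    by (simp only: phi_commute[of d ?U])
  then show ?thesis
    using UV by (simp add: mult.assoc)
qed

text \<open>Exchangeability provides existence in the definite description defining
  \<open>partition_fun\<close>; instantiating with \<open>i\<close> itself gives uniqueness.\<close>

lemma t_fun_Ker:
  assumes "set i \<subseteq> {1..}"
  shows "t_fun d (length i) (Ker i) = phi d (prod_list (map (centred_gen d) i))"
  unfolding t_fun_def partition_fun_def centred_gen_def[symmetric]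
proof (rule the_equality)
  show "\<forall>j. length j = length i \<and> set j \<subseteq> {1..} \<and> Ker j = Ker i \<longrightarrow>
      phi d (prod_list (map (centred_gen d) i)) = phi d (prod_list (map (centred_gen d) j))"
    using phi_centred_gen_exchangeable assms by metis
  show "z = phi d (prod_list (map (centred_gen d) i))"
    if "\<forall>j. length j = length i \<and> set j \<subseteq> {1..} \<and> Ker j = Ker i \<longrightarrow>
      z = phi d (prod_list (map (centred_gen d) j))" for z
    using that assms by blast
qed

text \<open>The letter at the singleton position occurs nowhere else, so the products to its left
  and right lie in \<open>fixing\<close> of the point it moves, and
  \<open>phi_centred_gen_fresh\<close> applies.\<close>

lemma t_fun_Ker_singleton:
  assumes i: "set i \<subseteq> {1..}" and B: "B \<in> Ker i" "card B = 1"
  shows "t_fun d (length i) (Ker i) = 0"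
proof -
  obtain l where l: "B = {l}"
    using B(2) by (rule card_1_singletonE)
  then have "l \<in> {1..length i}"
    using partition_onD1[OF partition_on_Ker] B(1) by auto
  then obtain x where x: "l = Suc x" "x < length i"
    by (cases l) auto
  have "y = x" if y: "y < length i" "i ! y = i ! x" for y
  proof -
    obtain m where m: "B = {m' \<in> {1..length i}. i ! (m' - 1) = i ! (m - 1)}"
      using B(1) by (auto simp: Ker_def)
    have "Suc x \<in> B"
      using l x by simp
    with m y have "Suc y \<in> B"
      by simp
    with l x show ?thesis
      by simp
  qed
  then have fresh: "i ! y \<noteq> i ! x" if "y < length i" "y \<noteq> x" for y
    using that by blast
  have "i ! x \<notin> set (take x i)" "i ! x \<notin> set (drop (Suc x) i)"
    using fresh x by (auto simp: in_set_conv_nth)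
  moreover have "set (take x i) \<subseteq> {1..}" "set (drop (Suc x) i) \<subseteq> {1..}" "i ! x \<ge> 1"
    using i set_take_subset[of x i] set_drop_subset[of "Suc x" i] nth_mem[OF x(2)] by fastforce+
  moreover have "prod_list (map (centred_gen d) u) \<in> fixing (n + 1)"
    if "n \<notin> set u" "set u \<subseteq> {1..}" "n \<ge> 1" for u n
  proof (rule fixing_prod_list)
    fix A assume "A \<in> set (map (centred_gen d) u)"
    then obtain m where "m \<in> set u" "A = centred_gen d m"
      by auto
    moreover from this have "m \<noteq> n" "m \<ge> 1"
      using that by auto
    ultimately show "A \<in> fixing (n + 1)"
      using centred_gen_fixing[of m n d] that by simp
  qed
  ultimately have "prod_list (map (centred_gen d) (take x i)) \<in> fixing (i ! x + 1)"
    and "prod_list (map (centred_gen d) (drop (Suc x) i)) \<in> fixing (i ! x + 1)" and "i ! x \<ge> 1"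
    by blast+
  then have "phi d (prod_list (map (centred_gen d) (take x i)) * centred_gen d (i ! x) *
      prod_list (map (centred_gen d) (drop (Suc x) i))) = 0"
    by (rule phi_centred_gen_fresh)
  moreover have "i = take x i @ i ! x # drop (Suc x) i"
    by (rule id_take_nth_drop[OF x(2)])
  then have "prod_list (map (centred_gen d) i) =
      prod_list (map (centred_gen d) (take x i)) * centred_gen d (i ! x) *
      prod_list (map (centred_gen d) (drop (Suc x) i))"
    by (metis (no_types, lifting) list.simps(9) map_append mult.assoc prod_list.Cons
        prod_list.append)
  ultimately show ?thesis
    by (simp add: t_fun_Ker[OF i])
qed

section \<open>The central limit theorem\<close>

text \<open>Distributivity: an index is chosen at each position of the word separately, also where a
  letter repeats, so the terms are indexed by lists parallel to \<open>w\<close>.\<close>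

lemma prod_list_sum:
  fixes X :: "'b \<Rightarrow> 'c \<Rightarrow> 'a::semiring_1"
  assumes "finite A"
  shows "prod_list (map (\<lambda>p. \<Sum>m\<in>A. X p m) w) =
    (\<Sum>ms | set ms \<subseteq> A \<and> length ms = length w. prod_list (map2 X w ms))"
proof (induction w)
  case Nil
  have "{ms. set ms \<subseteq> A \<and> ms = []} = {[]}"
    by auto
  then show ?case
    by simp
next
  case (Cons p w)
  let ?L = "\<lambda>k. {ms. set ms \<subseteq> A \<and> length ms = k}"
  have "(\<Sum>ms\<in>?L (length (p # w)). prod_list (map2 X (p # w) ms)) =
      (\<Sum>(ms, m)\<in>?L (length w) \<times> A. prod_list (map2 X (p # w) (m # ms)))"
    unfolding length_Cons lists_length_Suc_eq
    by (subst sum.reindex) (auto simp: inj_on_def intro!: sum.cong)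
  also have "\<dots> = (\<Sum>ms\<in>?L (length w). \<Sum>m\<in>A. X p m * prod_list (map2 X w ms))"
    by (simp add: sum.cartesian_product)
  also have "\<dots> = (\<Sum>m\<in>A. X p m) * (\<Sum>ms\<in>?L (length w). prod_list (map2 X w ms))"
    by (subst sum.swap) (simp add: sum_product)
  finally show ?case
    using Cons.IH by simp
qed

lemma sum_card_partition:
  fixes k :: nat
  assumes "partition_on {1..k} \<pi>"
  shows "(\<Sum>B\<in>\<pi>. card B) = k"
proof -
  have "finite B" if "B \<in> \<pi>" for B
    using assms that finite_subset[of B "{1..k}"] unfolding partition_on_def by blast
  then show ?thesis
    using product_partition[OF assms] by simp
qed

text \<open>The labels \<open>c p m\<close> express injectivity of the array through natural
  numbers. The locale serves two arrays: the arbitrary one of the theorem, and an explicit one that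
  yields positivity of the limit.\<close>

locale star_generator_array =
  fixes d r :: nat and c :: "nat \<Rightarrow> nat \<Rightarrow> nat" and g :: "nat \<times> nat \<Rightarrow> group_algebra"
  assumes d: "d \<ge> 1"
    and g: "\<And>p m. p \<in> {1..r} \<Longrightarrow> m \<ge> 1 \<Longrightarrow> g (p, m) = star_gen (c p m)"
    and c_pos: "\<And>p m. p \<in> {1..r} \<Longrightarrow> m \<ge> 1 \<Longrightarrow> c p m \<ge> 1"
    and c_inj: "\<And>p m p' m'. p \<in> {1..r} \<Longrightarrow> m \<ge> 1 \<Longrightarrow> p' \<in> {1..r} \<Longrightarrow> m' \<ge> 1 \<Longrightarrow>
      c p m = c p' m' \<Longrightarrow> p = p' \<and> m = m'"
begin

lemma normalized_sum_eq:
  assumes "p \<in> {1..r}"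
  shows "normalized_sum d g n p =
    scalar (1 / of_real (sqrt (real n))) * (\<Sum>m\<in>{1..n}. centred_gen d (c p m))"
proof -
  have "scalar (of_nat n / of_nat d) = (\<Sum>m\<in>{1..n}. scalar (1 / of_nat d) :: group_algebra)"
    using scalar_of_nat_mult[of n "1 / of_nat d"] by simp
  moreover have "(\<Sum>m\<in>{1..n}. g (p, m)) = (\<Sum>m\<in>{1..n}. star_gen (c p m))"
    by (rule sum.cong) (use g assms in auto)
  ultimately show ?thesis
    by (simp only: normalized_sum_def centred_gen_def sum_subtractf)
qed

definition index_lists :: "nat list \<Rightarrow> nat \<Rightarrow> nat list set" where
  "index_lists w n = {ms. set ms \<subseteq> {1..n} \<and> length ms = length w}"

lemma finite_index_lists: "finite (index_lists w n)"
  by (simp add: index_lists_def finite_lists_length_eq)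

text \<open>Injectivity of the labels is used here. In particular, the kernel of the labels is the
  common refinement of the kernels of \<open>w\<close> and \<open>ms\<close>.\<close>

lemma map2_c_nth_eq_iff:
  assumes w: "set w \<subseteq> {1..r}" and ms: "ms \<in> index_lists w n"
    and ms': "ms' \<in> index_lists w n" and x: "x < length w" and y: "y < length w"
  shows "map2 c w ms ! x = map2 c w ms' ! y \<longleftrightarrow> w ! x = w ! y \<and> ms ! x = ms' ! y"
proof -
  have "w ! x \<in> {1..r}" "w ! y \<in> {1..r}"
    using w x y nth_mem by blast+
  moreover have "ms ! x \<in> set ms" "ms' ! y \<in> set ms'"
    using ms ms' x y by (simp_all add: index_lists_def)
  then have "ms ! x \<ge> 1" "ms' ! y \<ge> 1"
    using ms ms' unfolding index_lists_def by auto
  moreover have "map2 c w ms ! x = c (w ! x) (ms ! x)" "map2 c w ms' ! y = c (w ! y) (ms' ! y)"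
    using ms ms' x y by (simp_all add: index_lists_def)
  ultimately show ?thesis
    using c_inj[of "w ! x" "ms ! x" "w ! y" "ms' ! y"] by auto
qed

lemma map2_c_index:
  assumes w: "set w \<subseteq> {1..r}" and ms: "ms \<in> index_lists w n"
  shows "length (map2 c w ms) = length w" and "set (map2 c w ms) \<subseteq> {1..}"
proof -
  show "length (map2 c w ms) = length w"
    using ms by (simp add: index_lists_def)
  show "set (map2 c w ms) \<subseteq> {1..}"
  proof
    fix z assume "z \<in> set (map2 c w ms)"
    then obtain p m where "(p, m) \<in> set (zip w ms)" "z = c p m"
      by auto
    then have "p \<in> set w" "m \<in> set ms"
      by (auto dest: set_zip_leftD set_zip_rightD)
    then have "p \<in> {1..r}" "m \<ge> 1"
      using w ms unfolding index_lists_def by auto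
    then show "z \<in> {1..}"
      using c_pos \<open>z = c p m\<close> by simp
  qed
qed

lemma phi_normalized_sum_word:
  assumes w: "set w \<subseteq> {1..r}"
  shows "phi d (prod_list (map (normalized_sum d g n) w)) =
    (1 / of_real (sqrt (real n))) ^ length w *
    (\<Sum>ms\<in>index_lists w n. t_fun d (length w) (Ker (map2 c w ms)))"
proof -
  have "map (normalized_sum d g n) w =
      map (\<lambda>p. scalar (1 / of_real (sqrt (real n))) * (\<Sum>m\<in>{1..n}. centred_gen d (c p m))) w"
    using w normalized_sum_eq by (intro map_cong) auto
  then have "prod_list (map (normalized_sum d g n) w) =
      scalar ((1 / of_real (sqrt (real n))) ^ length w) *
      (\<Sum>ms\<in>index_lists w n. prod_list (map2 (\<lambda>p m. centred_gen d (c p m)) w ms))"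
    by (simp only: prod_list_scalar_mult prod_list_sum[OF finite_atLeastAtMost] index_lists_def)
  then have "phi d (prod_list (map (normalized_sum d g n) w)) =
      (1 / of_real (sqrt (real n))) ^ length w *
      (\<Sum>ms\<in>index_lists w n. phi d (prod_list (map2 (\<lambda>p m. centred_gen d (c p m)) w ms)))"
    by (simp only: phi_def lin_ext_scalar_mult lin_ext_sum)
  also have "(\<Sum>ms\<in>index_lists w n. phi d (prod_list (map2 (\<lambda>p m. centred_gen d (c p m)) w ms))) =
      (\<Sum>ms\<in>index_lists w n. t_fun d (length w) (Ker (map2 c w ms)))"
  proof (rule sum.cong[OF refl])
    fix ms assume ms: "ms \<in> index_lists w n"
    have "map2 (\<lambda>p m. centred_gen d (c p m)) w ms = map (centred_gen d) (map2 c w ms)"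
      by (simp add: case_prod_unfold)
    then show "phi d (prod_list (map2 (\<lambda>p m. centred_gen d (c p m)) w ms)) =
        t_fun d (length w) (Ker (map2 c w ms))"
      using t_fun_Ker[OF map2_c_index(2)[OF w ms], of d] map2_c_index(1)[OF w ms] by metis
  qed
  finally show ?thesis .
qed

section \<open>Counting index tuples by kernel, and their asymptotic contribution\<close>

definition kernel_class :: "nat list \<Rightarrow> nat set set \<Rightarrow> nat \<Rightarrow> nat list set" where
  "kernel_class w \<pi> n = {ms \<in> index_lists w n. Ker (map2 c w ms) = \<pi>}"

text \<open>Replaces a summation range growing with \<open>n\<close> by a fixed finite set of
  partitions, so that limits can be taken term by term.\<close>

lemma sum_by_kernel:
  assumes w: "set w \<subseteq> {1..r}"
  shows "(\<Sum>ms\<in>index_lists w n. f (Ker (map2 c w ms))) =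
    (\<Sum>\<pi> | partition_on {1..length w} \<pi>. of_nat (card (kernel_class w \<pi> n)) * (f \<pi> :: complex))"
proof -
  have "(\<Sum>ms\<in>index_lists w n. f (Ker (map2 c w ms))) =
      (\<Sum>\<pi> | partition_on {1..length w} \<pi>. \<Sum>ms\<in>kernel_class w \<pi> n. f (Ker (map2 c w ms)))"
    unfolding kernel_class_def
  proof (rule sum.group[symmetric])
    show "(\<lambda>ms. Ker (map2 c w ms)) ` index_lists w n \<subseteq> {\<pi>. partition_on {1..length w} \<pi>}"
    proof (rule image_subsetI)
      fix ms assume "ms \<in> index_lists w n"
      then show "Ker (map2 c w ms) \<in> {\<pi>. partition_on {1..length w} \<pi>}"
        using partition_on_Ker[of "map2 c w ms"] by (simp only: map2_c_index(1)[OF w] mem_Collect_eq)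
    qed
  qed (simp_all add: finite_index_lists finitely_many_partition_on)
  also have "\<dots> = (\<Sum>\<pi> | partition_on {1..length w} \<pi>.
      of_nat (card (kernel_class w \<pi> n)) * f \<pi>)"
    by (intro sum.cong refl) (simp add: kernel_class_def)
  finally show ?thesis .
qed

lemma kernel_class_refines:
  assumes w: "set w \<subseteq> {1..r}" and ms: "ms \<in> kernel_class w \<pi> n"
  shows "refines {1..length w} \<pi> (Ker w)"
proof -
  let ?J = "map2 c w ms"
  have ms': "ms \<in> index_lists w n" and \<pi>: "\<pi> = Ker ?J"
    using ms by (auto simp: kernel_class_def)
  note len = map2_c_index(1)[OF w ms']
  have "\<exists>Y\<in>Ker w. X \<subseteq> Y" if X: "X \<in> \<pi>" for X
  proof -
    obtain m where m: "m \<in> {1..length w}"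
      and Xm: "X = {m' \<in> {1..length w}. ?J ! (m' - 1) = ?J ! (m - 1)}"
      using X unfolding \<pi> Ker_def len by blast
    have "X \<subseteq> {m' \<in> {1..length w}. w ! (m' - 1) = w ! (m - 1)}"
    proof
      fix m' assume "m' \<in> X"
      then have "m' \<in> {1..length w}" "?J ! (m' - 1) = ?J ! (m - 1)"
        by (auto simp: Xm)
      then show "m' \<in> {m' \<in> {1..length w}. w ! (m' - 1) = w ! (m - 1)}"
        using map2_c_nth_eq_iff[OF w ms' ms', of "m' - 1" "m - 1"] m by auto
    qed
    then show ?thesis
      using m by (auto simp: Ker_def)
  qed
  then show ?thesis
    unfolding refines_def using partition_on_Ker[of ?J] partition_on_Ker[of w] len \<pi> by simp
qed

text \<open>A tuple of the class is constant on every block, so its values at the least positions of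
  the blocks determine it.\<close>

lemma card_kernel_class_le:
  assumes w: "set w \<subseteq> {1..r}" and \<pi>: "partition_on {1..length w} \<pi>"
  shows "card (kernel_class w \<pi> n) \<le> n ^ card \<pi>"
proof -
  have fin: "finite \<pi>"
    using \<pi> finite_elements by blast
  have block: "B \<subseteq> {1..length w}" "B \<noteq> {}" "Min B \<in> B" if "B \<in> \<pi>" for B
  proof -
    show B: "B \<subseteq> {1..length w}" "B \<noteq> {}"
      using \<pi> that by (auto simp: partition_on_def)
    then show "Min B \<in> B"
      using finite_subset Min_in by blast
  qed
  \<comment> \<open>Subtracting 1 turns a position counted from 1 into a list index.\<close>
  let ?F = "\<lambda>ms. restrict (\<lambda>B. ms ! (Min B - 1)) \<pi>"
  have "card (kernel_class w \<pi> n) \<le> card (\<pi> \<rightarrow>\<^sub>E {1..n})"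
  proof (rule card_inj_on_le)
    show "finite (\<pi> \<rightarrow>\<^sub>E {1..n})"
      by (simp add: fin finite_PiE)
    show "?F ` kernel_class w \<pi> n \<subseteq> \<pi> \<rightarrow>\<^sub>E {1..n}"
    proof (rule image_subsetI, rule restrict_PiE_iff[THEN iffD2], rule ballI)
      fix ms B assume ms: "ms \<in> kernel_class w \<pi> n" and B: "B \<in> \<pi>"
      have "Min B \<in> {1..length ms}"
        using block[OF B] ms by (auto simp: kernel_class_def index_lists_def)
      then have "Min B - 1 < length ms"
        by auto
      then have "ms ! (Min B - 1) \<in> set ms"
        by (rule nth_mem)
      then show "ms ! (Min B - 1) \<in> {1..n}"
        using ms by (auto simp: kernel_class_def index_lists_def)
    qed
    show "inj_on ?F (kernel_class w \<pi> n)"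
    proof (rule inj_onI)
      fix ms ms' assume ms: "ms \<in> kernel_class w \<pi> n" and ms': "ms' \<in> kernel_class w \<pi> n"
        and eq: "?F ms = ?F ms'"
      have in_block: "us ! x = us ! (Min B - 1)"
        if us: "us \<in> kernel_class w \<pi> n" and B: "B \<in> \<pi>" and x: "Suc x \<in> B" for us B x
      proof -
        have "us \<in> index_lists w n" "B \<in> Ker (map2 c w us)"
          using us B by (auto simp: kernel_class_def)
        moreover have "Suc (Min B - 1) \<in> B" "x < length w" "Min B - 1 < length w"
          using block[OF B] x by force+
        ultimately show ?thesis
          using Ker_block_eq[of B "map2 c w us" x "Min B - 1"] x
            map2_c_nth_eq_iff[OF w, of us n us x "Min B - 1"] by blast
      qed
      show "ms = ms'"
      proof (rule nth_equalityI)
        show "length ms = length ms'"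
          using ms ms' by (simp add: kernel_class_def index_lists_def)
        fix x assume "x < length ms"
        then have "Suc x \<in> {1..length w}"
          using ms by (simp add: kernel_class_def index_lists_def)
        then obtain B where B: "B \<in> \<pi>" "Suc x \<in> B"
          using partition_onD1[OF \<pi>] by blast
        moreover have "ms ! (Min B - 1) = ms' ! (Min B - 1)"
          using fun_cong[OF eq, of B] B by simp
        ultimately show "ms ! x = ms' ! x"
          using in_block ms ms' by metis
      qed
    qed
  qed
  also have "\<dots> = n ^ card \<pi>"
    by (simp add: card_funcsetE fin)
  finally show ?thesis .
qed

text \<open>Distinct values on distinct blocks produce a tuple whose kernel is exactly
  \<open>\<pi>\<close>; within a block the letters of \<open>w\<close> agree because
  \<open>\<pi>\<close> refines \<open>Ker w\<close>. The product counts injective assignments, and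
  truncated subtraction makes it 0 when \<open>n < card \<pi>\<close>.\<close>

lemma card_kernel_class_ge:
  assumes w: "set w \<subseteq> {1..r}" and ref: "refines {1..length w} \<pi> (Ker w)"
  shows "(\<Prod>j<card \<pi>. n - j) \<le> card (kernel_class w \<pi> n)"
proof -
  have \<pi>: "partition_on {1..length w} \<pi>"
    using ref by (simp add: refines_def)
  then have fin: "finite \<pi>"
    using finite_elements by blast
  define blk where "blk y = (THE B. B \<in> \<pi> \<and> y \<in> B)" for y
  have blk: "blk y = B" if "B \<in> \<pi>" "y \<in> B" for y B
    unfolding blk_def
  proof (rule the_equality)
    show "B' = B" if "B' \<in> \<pi> \<and> y \<in> B'" for B'
      using that \<open>B \<in> \<pi>\<close> \<open>y \<in> B\<close> partition_onD2[OF \<pi>] disjointD by blast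
  qed (use that in simp)
  have blk_in: "blk y \<in> \<pi>" "y \<in> blk y" if "y \<in> {1..length w}" for y
  proof -
    have "y \<in> \<Union>\<pi>"
      using that by (simp only: partition_onD1[OF \<pi>, symmetric])
    then obtain B where "B \<in> \<pi>" "y \<in> B"
      by (rule UnionE)
    then show "blk y \<in> \<pi>" "y \<in> blk y"
      using blk by simp_all
  qed
  have blk_w: "w ! x = w ! y" if "x < length w" "y < length w" "blk (Suc x) = blk (Suc y)" for x y
  proof -
    have x: "blk (Suc x) \<in> \<pi>" "Suc x \<in> blk (Suc x)" "Suc y \<in> blk (Suc x)"
      using blk_in[of "Suc x"] blk_in[of "Suc y"] that by auto
    then obtain Y where "Y \<in> Ker w" "blk (Suc x) \<subseteq> Y"
      using ref by (auto simp: refines_def)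
    then show ?thesis
      using Ker_block_eq[of Y w x y] x by blast
  qed
  define I where "I = {h \<in> \<pi> \<rightarrow>\<^sub>E {1..n}. inj_on h \<pi>}"
  let ?F = "\<lambda>h. map (\<lambda>x. h (blk (Suc x))) [0..<length w]"
  have "(\<Prod>j<card \<pi>. n - j) = card I"
    unfolding I_def using card_inj_on_subset_funcset[of \<pi> "{1..n}" \<pi>] fin
    by (simp add: lessThan_atLeast0)
  also have "\<dots> \<le> card (kernel_class w \<pi> n)"
  proof (rule card_inj_on_le)
    show "finite (kernel_class w \<pi> n)"
      by (simp add: kernel_class_def finite_index_lists)
    show "inj_on ?F I"
    proof (rule inj_onI)
      fix h h' assume h: "h \<in> I" "h' \<in> I" and eq: "?F h = ?F h'"
      show "h = h'"
      proof (rule PiE_ext)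
        show "h \<in> \<pi> \<rightarrow>\<^sub>E {1..n}" "h' \<in> \<pi> \<rightarrow>\<^sub>E {1..n}"
          using h by (simp_all add: I_def)
        fix B assume B: "B \<in> \<pi>"
        then have "B \<noteq> {}" "B \<subseteq> {1..length w}"
          using \<pi> by (auto simp: partition_on_def)
        then obtain x where x: "Suc x \<in> B" "x < length w"
          by (metis Suc_le_lessD Suc_pred atLeastAtMost_iff equals0I less_eq_Suc_le One_nat_def subsetD)
        have "?F h ! x = ?F h' ! x"
          by (simp only: eq)
        then show "h B = h' B"
          using x blk[OF B x(1)] by simp
      qed
    qed
    show "?F ` I \<subseteq> kernel_class w \<pi> n"
    proof (rule image_subsetI)
      fix h assume h: "h \<in> I"
      have hmem: "h B \<in> {1..n}" if "B \<in> \<pi>" for B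
        using h that by (auto simp: I_def)
      have "h (blk (Suc x)) \<in> {1..n}" if "x < length w" for x
        using hmem blk_in[of "Suc x"] that by simp
      then have ms: "?F h \<in> index_lists w n"
        by (auto simp: index_lists_def)
      have eq: "map2 c w (?F h) ! x = map2 c w (?F h) ! y \<longleftrightarrow> blk (Suc x) = blk (Suc y)"
        if "x < length w" "y < length w" for x y
        using map2_c_nth_eq_iff[OF w ms ms that] blk_w[OF that] that blk_in[of "Suc x"]
          blk_in[of "Suc y"] h by (auto simp: I_def dest: inj_onD)
      have "Ker (map2 c w (?F h)) = blk ` {1..length w}"
        unfolding Ker_def map2_c_index(1)[OF w ms]
      proof (rule image_cong[OF refl])
        fix m assume m: "m \<in> {1..length w}"
        have "m' \<in> {1..length w} \<and> map2 c w (?F h) ! (m' - 1) = map2 c w (?F h) ! (m - 1) \<longleftrightarrow>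
            m' \<in> blk m" for m'
        proof (cases "m' \<in> {1..length w}")
          case True
          then have "map2 c w (?F h) ! (m' - 1) = map2 c w (?F h) ! (m - 1) \<longleftrightarrow> blk m' = blk m"
            using eq[of "m' - 1" "m - 1"] m by auto
          then show ?thesis
            using True blk_in m blk by metis
        next
          case False
          then show ?thesis
            using blk_in[OF m] partition_onD1[OF \<pi>] by blast
        qed
        then show "{m' \<in> {1..length w}. map2 c w (?F h) ! (m' - 1) = map2 c w (?F h) ! (m - 1)} = blk m"
          by blast
      qed
      also have "\<dots> = \<pi>"
      proof
        show "blk ` {1..length w} \<subseteq> \<pi>"
          using blk_in by blast
        show "\<pi> \<subseteq> blk ` {1..length w}"
        proof
          fix B assume B: "B \<in> \<pi>"
          then have "B \<subseteq> {1..length w}" "B \<noteq> {}"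
            using \<pi> by (auto simp: partition_on_def)
          then obtain y where "y \<in> B" "y \<in> {1..length w}"
            by blast
          then show "B \<in> blk ` {1..length w}"
            using blk[OF B] by blast
        qed
      qed
      finally show "?F h \<in> kernel_class w \<pi> n"
        using ms by (simp add: kernel_class_def)
    qed
  qed
  finally show ?thesis .
qed

text \<open>A pairing has half as many blocks as positions, so the normalization is \<open>n\<close>
  to the power \<open>card \<pi>\<close>. The count, squeezed between a falling factorial and this
  power, is asymptotic to it.\<close>

lemma pair_kernel_class_tendsto:
  assumes w: "set w \<subseteq> {1..r}" and pair: "\<pi> \<in> pair_partitions (length w)"
    and ref: "refines {1..length w} \<pi> (Ker w)"
  shows "(\<lambda>n. (1 / sqrt (real n)) ^ length w * real (card (kernel_class w \<pi> n))) \<longlonglongrightarrow> 1"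
proof -
  let ?q = "card \<pi>"
  have \<pi>: "partition_on {1..length w} \<pi>" and two: "\<forall>B\<in>\<pi>. card B = 2"
    using pair by (auto simp: pair_partitions_def)
  have len: "length w = 2 * ?q"
    using sum_card_partition[OF \<pi>] two by simp
  have lower: "(\<Prod>j<?q. real (n - j) / real n) \<le>
      (1 / sqrt (real n)) ^ length w * real (card (kernel_class w \<pi> n))" for n
  proof -
    have "real (\<Prod>j<?q. n - j) \<le> real (card (kernel_class w \<pi> n))"
      using card_kernel_class_ge[OF w ref] by (simp only: of_nat_le_iff)
    then have "(\<Prod>j<?q. real (n - j)) / real n ^ ?q \<le> real (card (kernel_class w \<pi> n)) / real n ^ ?q"
      by (simp add: divide_right_mono)
    then show ?thesis
      by (simp add: len power_mult power_divide prod_dividef)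
  qed
  have upper: "(1 / sqrt (real n)) ^ length w * real (card (kernel_class w \<pi> n)) \<le> 1"
    if "n > 0" for n
  proof -
    have "real (card (kernel_class w \<pi> n)) \<le> real n ^ ?q"
      using card_kernel_class_le[OF w \<pi>, of n] by (simp only: of_nat_le_iff flip: of_nat_power)
    then show ?thesis
      using that by (simp add: len power_mult power_divide)
  qed
  have "(\<lambda>n. real (n - j) / real n) \<longlonglongrightarrow> 1" for j
  proof -
    have "(\<lambda>n. 1 - real j * (1 / real n)) \<longlonglongrightarrow> 1 - real j * 0"
      by (intro tendsto_intros lim_1_over_n)
    moreover have "\<forall>\<^sub>F n in sequentially. 1 - real j * (1 / real n) = real (n - j) / real n"
      \<comment> \<open>From \<open>Suc j\<close> on, \<open>n\<close> is nonzero and the truncated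
        difference \<open>n - j\<close> agrees with the real one.\<close>
      using eventually_ge_at_top[of "Suc j"]
      by eventually_elim (simp add: of_nat_diff field_simps)
    ultimately show ?thesis
      using Lim_transform_eventually by fastforce
  qed
  then have "(\<lambda>n. \<Prod>j<?q. real (n - j) / real n) \<longlonglongrightarrow> (\<Prod>j<?q. 1)"
    by (rule tendsto_prod)
  then have lim: "(\<lambda>n. \<Prod>j<?q. real (n - j) / real n) \<longlonglongrightarrow> 1"
    by simp
  show ?thesis
  proof (rule tendsto_sandwich[OF _ _ lim tendsto_const])
    show "\<forall>\<^sub>F n in sequentially.
        (1 / sqrt (real n)) ^ length w * real (card (kernel_class w \<pi> n)) \<le> 1"
      using eventually_gt_at_top[of 0] by eventually_elim (rule upper)
  qed (use lower in simp)
qed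

text \<open>With all blocks of size at least 2 and one larger, there are fewer blocks than half the
  positions. The normalization beats the count by at least one factor
  \<open>1 / sqrt n\<close>.\<close>

lemma large_block_kernel_class_tendsto:
  assumes w: "set w \<subseteq> {1..r}" and \<pi>: "partition_on {1..length w} \<pi>"
    and ge2: "\<forall>B\<in>\<pi>. card B \<ge> 2" and large: "\<exists>B\<in>\<pi>. card B \<noteq> 2"
  shows "(\<lambda>n. (1 / sqrt (real n)) ^ length w * real (card (kernel_class w \<pi> n))) \<longlonglongrightarrow> 0"
proof -
  let ?q = "card \<pi>"
  have "finite \<pi>"
    by (rule finite_elements[OF _ \<pi>]) simp
  then have "(\<Sum>B\<in>\<pi>. 2) < (\<Sum>B\<in>\<pi>. card B)"
  proof (rule sum_strict_mono_ex1)
    show "\<exists>B\<in>\<pi>. 2 < card B"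
      using ge2 large by (metis le_neq_implies_less)
  qed (use ge2 in blast)
  then have "2 * ?q < length w"
    using sum_card_partition[OF \<pi>] by simp
  then obtain e where len: "length w = 2 * ?q + Suc e"
    by (auto dest!: less_imp_Suc_add)
  have upper: "(1 / sqrt (real n)) ^ length w * real (card (kernel_class w \<pi> n)) \<le> 1 / sqrt (real n)"
    if "n > 0" for n
  proof -
    have "real (card (kernel_class w \<pi> n)) \<le> real n ^ ?q"
      using card_kernel_class_le[OF w \<pi>, of n] by (simp only: of_nat_le_iff flip: of_nat_power)
    then have "(1 / sqrt (real n)) ^ length w * real (card (kernel_class w \<pi> n)) \<le>
        (1 / sqrt (real n)) ^ length w * real n ^ ?q"
      by (intro mult_left_mono) simp_all
    also have "\<dots> = (1 / sqrt (real n)) ^ Suc e"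
      using that by (simp add: len power_add power_mult power_divide)
    also have "\<dots> \<le> (1 / sqrt (real n)) ^ 1"
      using that by (intro power_decreasing) (simp_all add: Suc_le_eq)
    finally show ?thesis
      by simp
  qed
  have "(\<lambda>n. sqrt (1 / real n)) \<longlonglongrightarrow> sqrt 0"
    by (intro tendsto_real_sqrt lim_1_over_n)
  then have lim: "(\<lambda>n. 1 / sqrt (real n)) \<longlonglongrightarrow> 0"
    by (simp add: real_sqrt_divide)
  show ?thesis
  proof (rule tendsto_sandwich[OF _ _ tendsto_const lim])
    show "\<forall>\<^sub>F n in sequentially.
        (1 / sqrt (real n)) ^ length w * real (card (kernel_class w \<pi> n)) \<le> 1 / sqrt (real n)"
      using eventually_gt_at_top[of 0] by eventually_elim (rule upper)
  qed simp_all
qed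

text \<open>Pairings below \<open>Ker w\<close> survive. Every other partition is never realized as
  a kernel, has a singleton and so a vanishing moment, or has a block larger than 2 and is
  asymptotically negligible.\<close>

lemma kernel_class_term_tendsto:
  assumes w: "set w \<subseteq> {1..r}" and \<pi>: "partition_on {1..length w} \<pi>"
  shows "(\<lambda>n. (1 / of_real (sqrt (real n))) ^ length w *
      (of_nat (card (kernel_class w \<pi> n)) * t_fun d (length w) \<pi>)) \<longlonglongrightarrow>
    (if \<pi> \<in> pair_partitions (length w) \<and> refines {1..length w} \<pi> (Ker w)
      then t_fun d (length w) \<pi> else 0)"
proof -
  let ?a = "\<lambda>n. (1 / sqrt (real n)) ^ length w * real (card (kernel_class w \<pi> n))"
  let ?t = "t_fun d (length w) \<pi>"
  let ?L = "if \<pi> \<in> pair_partitions (length w) \<and> refines {1..length w} \<pi> (Ker w) then ?t else 0"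
  have "(\<lambda>n. of_real (?a n) * ?t) \<longlonglongrightarrow> ?L"
  proof (cases "\<pi> \<in> pair_partitions (length w) \<and> refines {1..length w} \<pi> (Ker w)")
    case True
    then have "(\<lambda>n. of_real (?a n) * ?t) \<longlonglongrightarrow> of_real 1 * ?t"
      using pair_kernel_class_tendsto[OF w] by (intro tendsto_intros) auto
    with True show ?thesis
      by simp
  next
    case False
    have "(\<lambda>n. of_real (?a n) * ?t) \<longlonglongrightarrow> 0"
    \<comment> \<open>A tuple in some class shows that \<open>\<pi>\<close> refines
      \<open>Ker w\<close> and gives labels at which \<open>t_fun\<close> can be evaluated. If all
      classes are empty, every term is 0.\<close>
    proof (cases "\<exists>n. kernel_class w \<pi> n \<noteq> {}")
      case True
      then obtain n ms where ms: "ms \<in> kernel_class w \<pi> n"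
        by blast
      then have ms': "ms \<in> index_lists w n" and Ker: "Ker (map2 c w ms) = \<pi>"
        by (auto simp: kernel_class_def)
      have not_pair: "\<pi> \<notin> pair_partitions (length w)"
        using False kernel_class_refines[OF w ms] by blast
      show ?thesis
      proof (cases "\<exists>B\<in>\<pi>. card B = 1")
        case True
        then have "?t = 0"
          using t_fun_Ker_singleton[OF map2_c_index(2)[OF w ms'], of _ d] map2_c_index(1)[OF w ms']
          by (auto simp only: Ker)
        then show ?thesis
          by simp
      next
        case False
        have "card B \<ge> 2" if B: "B \<in> \<pi>" for B
        proof -
          have "B \<subseteq> {1..length w}" "B \<noteq> {}"
            using \<pi> B by (auto simp: partition_on_def)
          then have "card B \<noteq> 0"
            by (metis card_0_eq finite_atLeastAtMost finite_subset)
          then show ?thesis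
            using False B by (metis One_nat_def Suc_1 less_2_cases not_less)
        qed
        moreover have "\<exists>B\<in>\<pi>. card B \<noteq> 2"
          using not_pair \<pi> by (auto simp: pair_partitions_def)
        ultimately have "?a \<longlonglongrightarrow> 0"
          by (intro large_block_kernel_class_tendsto[OF w \<pi>]) auto
        then have "(\<lambda>n. of_real (?a n) * ?t) \<longlonglongrightarrow> of_real 0 * ?t"
          by (intro tendsto_intros)
        then show ?thesis
          by simp
      qed
    qed simp
    with False show ?thesis
      by auto
  qed
  then show ?thesis
    by (simp add: mult.assoc)
qed

lemma moments_tendsto:
  assumes w: "set w \<subseteq> {1..r}"
  shows "(\<lambda>n. phi d (prod_list (map (normalized_sum d g n) w))) \<longlonglongrightarrow> limit_moment d w"
proof (cases "w = []")
  case True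
  then show ?thesis
    by (simp add: limit_moment_def)
next
  case False
  let ?Q = "{\<pi>. partition_on {1..length w} \<pi>}"
  let ?P = "\<lambda>\<pi>. \<pi> \<in> pair_partitions (length w) \<and> refines {1..length w} \<pi> (Ker w)"
  have "phi d (prod_list (map (normalized_sum d g n) w)) =
      (\<Sum>\<pi>\<in>?Q. (1 / of_real (sqrt (real n))) ^ length w *
        (of_nat (card (kernel_class w \<pi> n)) * t_fun d (length w) \<pi>))" for n
    by (simp only: phi_normalized_sum_word[OF w] sum_by_kernel[OF w] sum_distrib_left)
  moreover have "(\<lambda>n. \<Sum>\<pi>\<in>?Q. (1 / of_real (sqrt (real n))) ^ length w *
        (of_nat (card (kernel_class w \<pi> n)) * t_fun d (length w) \<pi>)) \<longlonglongrightarrow>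
      (\<Sum>\<pi>\<in>?Q. if ?P \<pi> then t_fun d (length w) \<pi> else 0)"
    by (intro tendsto_sum kernel_class_term_tendsto[OF w]) simp
  moreover have "(\<Sum>\<pi>\<in>?Q. if ?P \<pi> then t_fun d (length w) \<pi> else 0) = limit_moment d w"
  proof -
    have "?Q \<inter> {\<pi>. ?P \<pi>} = {\<pi>. ?P \<pi>}"
      by (auto simp: pair_partitions_def)
    then show ?thesis
      using False finitely_many_partition_on[of "{1..length w}"]
      by (simp add: sum.If_cases limit_moment_def)
  qed
  ultimately show ?thesis
    by simp
qed

section \<open>Joint distributions of the normalized sums: convergence and positivity\<close>

lemma joint_distribution_tendsto:
  assumes P: "P \<in> ncpolys {1..r}"
  shows "(\<lambda>n. joint_distribution (phi d) r (normalized_sum d g n) P) \<longlonglongrightarrow>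
    lin_ext (\<lambda>w. limit_moment d (letters w)) P"
proof -
  have "joint_distribution (phi d) r (normalized_sum d g n) P =
      (\<Sum>w\<in>Poly_Mapping.keys P. Poly_Mapping.lookup P w *
        phi d (prod_list (map (normalized_sum d g n) (letters w))))" for n
    using P by (simp add: joint_distribution_def lin_ext_def)
  moreover have "(\<lambda>n. \<Sum>w\<in>Poly_Mapping.keys P. Poly_Mapping.lookup P w *
        phi d (prod_list (map (normalized_sum d g n) (letters w)))) \<longlonglongrightarrow>
      lin_ext (\<lambda>w. limit_moment d (letters w)) P"
    unfolding lin_ext_def
    using P by (intro tendsto_sum tendsto_mult tendsto_const moments_tendsto) (auto simp: ncpolys_def)
  ultimately show ?thesis
    by simp
qed

text \<open>Transpositions are their own inverses and all coefficients are real. The involution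
  reverses products, which is harmless since scalars are central.\<close>

lemma conj_ext_normalized_sum:
  assumes "p \<in> {1..r}"
  shows "conj_ext uminus (normalized_sum d g n p) = normalized_sum d g n p"
proof -
  have scalar: "conj_ext uminus (scalar (of_real x)) = (scalar (of_real x) :: group_algebra)" for x
    by (simp add: scalar_def)
  have "- transp 1 (m + 1) = transp 1 (m + 1)" for m
    by (rule Rep_S_inf_inject[THEN iffD1]) simp
  then have "conj_ext uminus (star_gen m) = star_gen m" for m
    by (simp only: star_gen_conv_transp conj_ext_single complex_cnj_one)
  then have gen: "conj_ext uminus (centred_gen d m) = centred_gen d m" for m
    using scalar[of "1 / of_nat d"] by (simp add: centred_gen_def conj_ext_diff)
  have "conj_ext uminus (normalized_sum d g n p) =
      (\<Sum>m\<in>{1..n}. centred_gen d (c p m)) * scalar (of_real (1 / sqrt (real n)))"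
    using normalized_sum_eq[OF assms, of n] scalar[of "1 / sqrt (real n)"]
    by (simp add: conj_ext_mult minus_add conj_ext_sum gen)
  then show ?thesis
    using normalized_sum_eq[OF assms, of n] by (simp add: scalar_commute)
qed

text \<open>Evaluating \<open>P\<close> at the normalized sums gives \<open>Q\<close>. Since these
  are selfadjoint, reversed words evaluate to adjoints, so the claim reduces to positivity of
  \<open>phi\<close> at \<open>Q\<close>.\<close>

lemma joint_moment_positive:
  assumes P: "P \<in> ncpolys {1..r}"
  shows "lin_ext (\<lambda>w. phi d (prod_list (map (normalized_sum d g n) (letters w))))
    (ncpoly_star P * P) \<in> \<real>\<^sub>\<ge>\<^sub>0"
proof -
  let ?K = "Poly_Mapping.keys P" and ?p = "Poly_Mapping.lookup P"
  let ?ev = "\<lambda>w. prod_list (map (normalized_sum d g n) w)"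
  define Q where "Q = (\<Sum>w\<in>?K. scalar (?p w) * ?ev (letters w))"
  have ev_rev: "conj_ext uminus (?ev w) = ?ev (rev w)" if "set w \<subseteq> {1..r}" for w
    using that
  proof (induction w)
    case Nil
    show ?case
      unfolding list.map prod_list.Nil rev.simps single_one[symmetric] conj_ext_single by simp
  next
    case (Cons p w)
    then show ?case
      by (simp add: conj_ext_mult minus_add conj_ext_normalized_sum)
  qed
  have scalar: "conj_ext uminus (scalar x) = (scalar (cnj x) :: group_algebra)" for x
    by (simp add: scalar_def)
  have "conj_ext uminus Q = (\<Sum>w\<in>?K. scalar (cnj (?p w)) * ?ev (rev (letters w)))"
    unfolding Q_def conj_ext_sum
  proof (rule sum.cong[OF refl])
    fix w assume "w \<in> ?K"
    then have "set (letters w) \<subseteq> {1..r}"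
      using P by (auto simp: ncpolys_def)
    then show "conj_ext uminus (scalar (?p w) * ?ev (letters w)) =
        scalar (cnj (?p w)) * ?ev (rev (letters w))"
      by (simp add: conj_ext_mult minus_add ev_rev scalar scalar_commute)
  qed
  then have "conj_ext uminus Q * Q = (\<Sum>u\<in>?K. \<Sum>v\<in>?K.
      scalar (cnj (?p u)) * ?ev (rev (letters u)) * (scalar (?p v) * ?ev (letters v)))"
    by (simp only: Q_def sum_product)
  also have "\<dots> = (\<Sum>u\<in>?K. \<Sum>v\<in>?K.
      scalar (cnj (?p u) * ?p v) * ?ev (letters (Word (rev (letters u)) + v)))"
  proof (intro sum.cong refl)
    fix u v
    have "scalar a * X * (scalar b * Y) = scalar (a * b) * (X * Y)" for a b and X Y :: group_algebra
      by (metis mult.assoc scalar_commute scalar_mult)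
    then show "scalar (cnj (?p u)) * ?ev (rev (letters u)) * (scalar (?p v) * ?ev (letters v)) =
        scalar (cnj (?p u) * ?p v) * ?ev (letters (Word (rev (letters u)) + v))"
      by (simp add: plus_nc_word_def)
  qed
  finally have "phi d (conj_ext uminus Q * Q) =
      lin_ext (\<lambda>w. phi d (?ev (letters w))) (ncpoly_star P * P)"
    by (simp add: ncpoly_star_conv_conj_ext lin_ext_conj_ext_mult phi_def lin_ext_sum
        lin_ext_scalar_mult)
  then show ?thesis
    using phi_positive[OF d, of Q] by simp
qed

end

section \<open>Positivity of the limit functional and conclusion\<close>

lemma ncpolys_mono: "I \<subseteq> J \<Longrightarrow> ncpolys I \<subseteq> ncpolys J"
  by (auto simp: ncpolys_def)

lemma ncpolys_add: "P \<in> ncpolys I \<Longrightarrow> Q \<in> ncpolys I \<Longrightarrow> P + Q \<in> ncpolys I"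
  using keys_add[of P Q] by (fastforce simp: ncpolys_def)

lemma ncpolys_scalar_mult: "P \<in> ncpolys I \<Longrightarrow> scalar c * P \<in> ncpolys I"
  using keys_scalar_mult[of c P] by (fastforce simp: ncpolys_def)

lemma ncpolys_star_mult:
  assumes "P \<in> ncpolys I" and "Q \<in> ncpolys I"
  shows "ncpoly_star P * Q \<in> ncpolys I"
proof -
  have "Poly_Mapping.keys (ncpoly_star P) \<subseteq> (\<lambda>w. Word (rev (letters w))) ` Poly_Mapping.keys P"
    unfolding ncpoly_star_def by (rule order.trans[OF keys_sum]) auto
  then have "set (letters w) \<subseteq> I" if "w \<in> Poly_Mapping.keys (ncpoly_star P)" for w
    using assms(1) that by (fastforce simp: ncpolys_def)
  moreover have "set (letters w) \<subseteq> I" if "w \<in> Poly_Mapping.keys Q" for w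
    using assms(2) that by (simp add: ncpolys_def)
  ultimately show ?thesis
    using keys_mult[of "ncpoly_star P" Q] by (fastforce simp: ncpolys_def plus_nc_word_def)
qed

lemma nonneg_Reals_limit:
  fixes x :: "nat \<Rightarrow> complex"
  assumes "x \<longlonglongrightarrow> l" and "\<And>n. x n \<in> \<real>\<^sub>\<ge>\<^sub>0"
  shows "l \<in> \<real>\<^sub>\<ge>\<^sub>0"
proof -
  have "0 \<le> Re (x n)" "Im (x n) = 0" for n
    using assms(2)[of n] by (simp_all add: complex_nonneg_Reals_iff)
  then have "0 \<le> Re l" "Im l = 0"
    using LIMSEQ_le_const[OF tendsto_Re[OF assms(1)]] tendsto_Im[OF assms(1)]
    by (auto simp: LIMSEQ_const_iff)
  then show ?thesis
    by (simp add: complex_nonneg_Reals_iff)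
qed

text \<open>A polynomial involves finitely many indeterminates, so its value is a limit of values of
  joint distributions of a suitable finite array, each of them nonnegative.\<close>

lemma limit_functional_positive:
  assumes d: "d \<ge> 1" and P: "P \<in> ncpolys {1..}"
  shows "lin_ext (\<lambda>w. limit_moment d (letters w)) (ncpoly_star P * P) \<in> \<real>\<^sub>\<ge>\<^sub>0"
proof -
  let ?A = "\<Union>w\<in>Poly_Mapping.keys P. set (letters w)"
  \<comment> \<open>Inserting 0 keeps the maximum meaningful for a constant polynomial.\<close>
  define r where "r = Max (insert 0 ?A)"
  have "x \<le> r" if "x \<in> ?A" for x
    unfolding r_def by (rule Max_ge) (use that in auto)
  then have Pr: "P \<in> ncpolys {1..r}"
    using P by (fastforce simp: ncpolys_def)
  \<comment> \<open>The pairing function makes the labels injective; adding 1 makes them legitimate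
    indices of star-generators.\<close>
  define c :: "nat \<Rightarrow> nat \<Rightarrow> nat" where "c p m = prod_encode (p, m) + 1" for p m
  define g :: "nat \<times> nat \<Rightarrow> group_algebra" where "g = (\<lambda>(p, m). star_gen (c p m))"
  interpret star_generator_array d r c g
    by unfold_locales (use d in \<open>auto simp: c_def g_def prod_encode_eq\<close>)
  show ?thesis
  proof (rule nonneg_Reals_limit)
    show "(\<lambda>n. joint_distribution (phi d) r (normalized_sum d g n) (ncpoly_star P * P))
        \<longlonglongrightarrow> lin_ext (\<lambda>w. limit_moment d (letters w)) (ncpoly_star P * P)"
      by (rule joint_distribution_tendsto[OF ncpolys_star_mult[OF Pr Pr]])
    show "joint_distribution (phi d) r (normalized_sum d g n) (ncpoly_star P * P) \<in> \<real>\<^sub>\<ge>\<^sub>0" for n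
      using joint_moment_positive[OF Pr] ncpolys_star_mult[OF Pr Pr]
      by (simp add: joint_distribution_def)
  qed
qed

lemma mu_inf_eq: "P \<in> ncpolys {1..} \<Longrightarrow> mu_inf d P = lin_ext (\<lambda>w. limit_moment d (letters w)) P"
  by (simp add: mu_inf_def)

lemma mu_r_eq:
  assumes "P \<in> ncpolys {1..r}"
  shows "mu_r r d P = lin_ext (\<lambda>w. limit_moment d (letters w)) P"
proof -
  have "P \<in> ncpolys {1..}"
    using assms ncpolys_mono[of "{1..r}" "{1..}"] by auto
  then show ?thesis
    using assms by (simp add: mu_r_def mu_inf_eq)
qed

lemma mu_r_distribution:
  assumes "d \<ge> 1"
  shows "mu_r r d \<in> distributions r"
proof -
  have "mu_r r d \<in> linear_functionals {1..r}"
    by (simp add: linear_functionals_def mu_r_eq ncpolys_add ncpolys_scalar_mult lin_ext_add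
        lin_ext_scalar_mult) (simp add: mu_r_def)
  moreover have "positive_functional {1..r} (mu_r r d)"
    unfolding positive_functional_def
  proof
    fix P assume P: "P \<in> ncpolys {1..r}"
    then have "P \<in> ncpolys {1..}"
      using ncpolys_mono[of "{1..r}" "{1..}"] by auto
    then show "mu_r r d (ncpoly_star P * P) \<in> \<real>\<^sub>\<ge>\<^sub>0"
      using limit_functional_positive[OF assms] mu_r_eq ncpolys_star_mult[OF P P] by simp
  qed
  moreover have "mu_r r d 1 = 1"
  proof -
    have "(1::ncpoly) \<in> ncpolys {1..r}"
      by (simp add: ncpolys_def zero_nc_word_def)
    moreover have "lin_ext (\<lambda>w. limit_moment d (letters w)) (1::ncpoly) = 1"
      unfolding single_one[symmetric] lin_ext_single
      by (simp add: limit_moment_def zero_nc_word_def)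
    ultimately show ?thesis
      by (simp add: mu_r_eq)
  qed
  ultimately show ?thesis
    by (simp add: distributions_def)
qed

theorem proposition1p11:
  fixes d r :: nat
  assumes "d \<ge> 1" and "r \<ge> 1"
  shows "positive_functional {1..} (mu_inf d) \<and>
         mu_r r d \<in> distributions r \<and>
         (\<forall>g :: nat \<times> nat \<Rightarrow> group_algebra.
            g \<in> {1..r} \<times> {1..} \<rightarrow> star_gen ` {1..} \<and> inj_on g ({1..r} \<times> {1..}) \<longrightarrow>
            converges_in_moments r
              (\<lambda>n. joint_distribution (phi d) r (normalized_sum d g n)) (mu_r r d))"
proof (intro conjI allI impI)
  show "positive_functional {1..} (mu_inf d)"
    unfolding positive_functional_def
    using limit_functional_positive[OF assms(1)] by (simp add: mu_inf_eq ncpolys_star_mult)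
  show "mu_r r d \<in> distributions r"
    by (rule mu_r_distribution[OF assms(1)])
next
  fix g :: "nat \<times> nat \<Rightarrow> group_algebra"
  assume "g \<in> {1..r} \<times> {1..} \<rightarrow> star_gen ` {1..} \<and> inj_on g ({1..r} \<times> {1..})"
  then have mem: "g \<in> {1..r} \<times> {1..} \<rightarrow> star_gen ` {1..}" and inj: "inj_on g ({1..r} \<times> {1..})"
    by blast+
  \<comment> \<open>Chooses an index for the generator at each place of the array. Equal labels then
    give equal generators, so injectivity of \<open>g\<close> yields that of
    \<open>c\<close>.\<close>
  define c where "c p m = (SOME q. q \<ge> 1 \<and> g (p, m) = star_gen q)" for p m
  have c: "c p m \<ge> 1 \<and> g (p, m) = star_gen (c p m)" if "p \<in> {1..r}" "m \<ge> 1" for p m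
  proof -
    have "g (p, m) \<in> star_gen ` {1..}"
      using that by (intro funcset_mem[OF mem]) simp
    then obtain q where "q \<ge> 1 \<and> g (p, m) = star_gen q"
      by auto
    then show ?thesis
      unfolding c_def by (rule someI)
  qed
  interpret star_generator_array d r c g
  proof
    fix p m p' m'
    assume *: "p \<in> {1..r}" "m \<ge> 1" "p' \<in> {1..r}" "m' \<ge> 1" "c p m = c p' m'"
    then have "g (p, m) = g (p', m')"
      using c by metis
    then show "p = p' \<and> m = m'"
      using inj_onD[OF inj, of "(p, m)" "(p', m')"] * by simp
  qed (use assms c in auto)
  show "converges_in_moments r (\<lambda>n. joint_distribution (phi d) r (normalized_sum d g n)) (mu_r r d)"
    unfolding converges_in_moments_def using joint_distribution_tendsto by (simp add: mu_r_eq)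
qed

end
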